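(* Let $J\subseteq I$, $\nu\in\Lambda_{\Phi_J}^+$, and write $\nu=\sum_{j\in J}\nu_j\omega_j^J$. Suppose $R$ is a $\Phi_J$-structured poset. Suppose also that $\mathrm{WGF}(R)|_J$ is $W_J$-invariant. (In this setting, the latter is guaranteed if, for example, for all $j\in J$ the $j$-components of $R$ are rank symmetric.) Let $\mathcal S=\mathcal S_{J,\nu}(R)$ be a subset of $\{\mathbf x\in R:\delta_j(\mathbf x)\le\nu_j\text{ for all }j\in J\}$. Suppose $\kappa:R\setminus\mathcal S\to J$ is a vertex-coloring function such that for each $\mathbf x\in R\setminus\mathcal S$ with $k:=\kappa(\mathbf x)$ we have: (1) the restriction of the rank function $\rho_k:\mathrm{comp}_k(\mathbf x)\to\{0,1,\dots,l_k(\mathbf x)\}$ to $\mathsf K(\mathbf x)$ is a rank function with range $\{0,1,\dots,l_k(\mathbf x)-(\nu_k+1)\}$, and (2) $\mathsf K(\mathbf x)$ has a symmetric chain decomposition with respect to the rank function $\rho_k|_{\mathsf K(\mathbf x)}$. Then $\nu+wt^J(\mathbf s)\in\Lambda_{\Phi_J}^+$ for all $\mathbf s\in\mathcal S$ and $R$ is a $(J,\nu)$-splitting poset with $$\chi^{\Phi_J}_\nu\cdot\mathrm{WGF}(R)|_J=\sum_{\mathbf s\in\mathcal S_{J,\nu}(R)}\chi^{\Phi_J}_{\nu+wt^J(\mathbf s)}.$$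
   Context: Root systems. $\Phi$ is a finite (reduced, crystallographic) root system in a Euclidean space with simple roots $\{\alpha_i\}_{i\in I}$, $\alpha^\vee=2\alpha/\langle\alpha,\alpha\rangle$, fundamental weights $\omega_i$ dual to simple coroots, $\Lambda=\bigoplus\mathbb Z\omega_i$, $\Lambda^+=\bigoplus\mathbb Z_{\ge0}\omega_i$, Weyl group $W$, $\varrho=\sum\omega_i$. $\mathbb Z[\Lambda]$ is the group ring with basis $\{e^\mu\}$, $w.e^\mu=e^{w(\mu)}$; $\mathcal A(e^\mu)=\sum_{w\in W}\det(w)e^{w(\mu)}$. For $\lambda\in\Lambda^+$ the Weyl bialternant $\chi_\lambda$ is the unique element of $\mathbb Z[\Lambda]$ with $\mathcal A(e^\varrho)\chi_\lambda=\mathcal A(e^{\lambda+\varrho})$. For $J\subseteq I$, $\Phi_J$ is the root subsystem with simple roots $\{\alpha_j\}_{j\in J}$, with Weyl group $W_J$, fundamental weights $\omega_j^J$, weight lattice $\Lambda_{\Phi_J}$, dominant weights $\Lambda_{\Phi_J}^+$, bialternants $\chi^{\Phi_J}_\nu$. For $\mu=\sum m_i\omega_i$ put $\mu^J=\sum_{j\in J}m_j\omega_j^J$, and for $\chi=\sum c_\mu e^\mu$ put $\chi|_J=\sum c_\mu e^{\mu^J}$. Posets. All posets are finite, identified with Hasse diagrams. A rank function on a poset is a surjection $\rho$ onto some $\{0,\dots,l\}$ with $\rho(\mathbf s)+1=\rho(\mathbf t)$ whenever $\mathbf t$ covers $\mathbf s$; $l$ is the length; the poset is rank symmetric if $|\rho^{-1}(i)|=|\rho^{-1}(l-i)|$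 for $0\le i\le l$. $R$ is a ranked poset with Hasse edges colored by $I$. The $i$-component $\mathrm{comp}_i(\mathbf x)$ is the connected component of $\mathbf x$ using only color $i$ edges; $\rho_i(\mathbf x)$ is the rank of $\mathbf x$ there, $l_i(\mathbf x)$ the length of this component, $\delta_i=l_i-\rho_i$, $m_i=\rho_i-\delta_i$, $wt^J(\mathbf x)=\sum_{j\in J}m_j(\mathbf x)\omega_j^J$, $wt=wt^I$, $\mathrm{WGF}(R)=\sum_{\mathbf x}e^{wt(\mathbf x)}$. $R$ is $\Phi$-structured if $wt(\mathbf s)+\alpha_i=wt(\mathbf t)$ whenever $\mathbf s\xrightarrow{i}\mathbf t$ in $R$, and $\Phi_J$-structured if $wt^J(\mathbf s)+\alpha_j=wt^J(\mathbf t)$ whenever $\mathbf s\xrightarrow{j}\mathbf t$ with $j\in J$. A $(J,\nu)$-splitting poset is defined to be a $\Phi$-structured poset $R$ together with a set $\mathcal S_{J,\nu}(R)\subseteq R$ for which $\nu+wt^J(\mathbf s)\in\Lambda^+_{\Phi_J}$ for all $\mathbf s\in\mathcal S_{J,\nu}(R)$ and $\chi^{\Phi_J}_\nu\cdot\mathrm{WGF}(R)|_J=\sum_{\mathbf s\in\mathcal S_{J,\nu}(R)}\chi^{\Phi_J}_{\nu+wt^J(\mathbf s)}$. Kindred sets. Given $\mathcal S\subseteq R$ and $\kappa:R\setminus\mathcal S\to J$, the kindred set of $\mathbf x\in R\setminus\mathcal S$ is $\mathsf K(\mathbf x)=\{\mathbf y\in\mathrm{comp}_{\kappa(\mathbf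 x)}(\mathbf x):\mathbf y\in R\setminus\mathcal S,\ \kappa(\mathbf y)=\kappa(\mathbf x)\}$. In the subgraph of $R$ induced by the vertices of $\mathsf K(\mathbf x)$, each connected component is regarded as a subposet of $\mathrm{comp}_{\kappa(\mathbf x)}(\mathbf x)$ in the induced order, and $\mathsf K(\mathbf x)$ is viewed as the disjoint sum of these subposets. A poset with rank function $\rho$ of length $l$ has a symmetric chain decomposition if as a set it is a disjoint union of chains $R_1,\dots,R_r$ such that, with $\mathbf x_i$ and $\mathbf y_i$ the minimal and maximal elements of $R_i$, $\rho(\mathbf x_i)+\rho(\mathbf y_i)=l$ and $\rho(\mathbf y_i)-\rho(\mathbf x_i)$ is the length (number of elements minus one) of $R_i$.
   Formalization: Since a splitting poset is by definition Φ-structured while R is only assumed Φ_J-structured, "R is a (J,ν)-splitting poset" is concluded only when R is also Φ-structured; the dominance claim and the displayed identity are proved for every Φ_J-structured R. *)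

theory Defs
  imports "HOL-Analysis.Analysis" "HOL-Library.Poly_Mapping" "HOL-Library.Disjoint_Sets"
begin

section \<open>Root systems, weights and Weyl groups\<close>

definition coroot :: "real ^ 'n \<Rightarrow> real ^ 'n" where
  "coroot a = (2 / (a \<bullet> a)) *\<^sub>R a"

definition reflection :: "real ^ 'n \<Rightarrow> real ^ 'n \<Rightarrow> real ^ 'n" where
  "reflection a v = v - (v \<bullet> coroot a) *\<^sub>R a"

text \<open>A finite reduced crystallographic root system. It is not required to span the
  ambient space: its Euclidean space is \<^term>\<open>span \<Phi>\<close>. In this way a root system and its
  subsystems live in the same type, and the empty root system is included.\<close>

definition root_system :: "(real ^ 'n) set \<Rightarrow> bool" where
  "root_system \<Phi> \<longleftrightarrow> finite \<Phi> \<and> 0 \<notin> \<Phi> \<and>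
     (\<forall>a\<in>\<Phi>. \<forall>b\<in>\<Phi>. reflection a b \<in> \<Phi>) \<and>
     (\<forall>a\<in>\<Phi>. \<forall>b\<in>\<Phi>. b \<bullet> coroot a \<in> \<int>) \<and>
     (\<forall>a\<in>\<Phi>. \<forall>c. c *\<^sub>R a \<in> \<Phi> \<longrightarrow> c = 1 \<or> c = -1)"

definition simple_roots :: "(real ^ 'n) set \<Rightarrow> ('i \<Rightarrow> real ^ 'n) \<Rightarrow> 'i set \<Rightarrow> bool" where
  "simple_roots \<Phi> \<alpha> I \<longleftrightarrow> inj_on \<alpha> I \<and> \<alpha> ` I \<subseteq> \<Phi> \<and> independent (\<alpha> ` I) \<and>
     (\<forall>b\<in>\<Phi>. \<exists>c :: 'i \<Rightarrow> int. b = (\<Sum>i\<in>I. of_int (c i) *\<^sub>R \<alpha> i) \<and>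
        ((\<forall>i\<in>I. 0 \<le> c i) \<or> (\<forall>i\<in>I. c i \<le> 0)))"

text \<open>The subsystem \<open>\<Phi>\<^sub>J\<close>; its simple roots are the \<open>\<alpha> j\<close> with \<open>j \<in> J\<close>. The weight-theoretic
  notions below take \<open>\<alpha>\<close> and the index set of simple roots, so that they apply both to \<open>\<Phi>\<close>
  (index set \<open>I\<close>) and to \<open>\<Phi>\<^sub>J\<close> (index set \<open>J\<close>).\<close>

definition subsystem :: "(real ^ 'n) set \<Rightarrow> ('i \<Rightarrow> real ^ 'n) \<Rightarrow> 'i set \<Rightarrow> (real ^ 'n) set" where
  "subsystem \<Phi> \<alpha> J = \<Phi> \<inter> span (\<alpha> ` J)"

definition fund_weight :: "('i \<Rightarrow> real ^ 'n) \<Rightarrow> 'i set \<Rightarrow> 'i \<Rightarrow> real ^ 'n" where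
  "fund_weight \<alpha> J j =
     (THE v. v \<in> span (\<alpha> ` J) \<and> (\<forall>k\<in>J. v \<bullet> coroot (\<alpha> k) = (if k = j then 1 else 0)))"

definition weight_lattice :: "('i \<Rightarrow> real ^ 'n) \<Rightarrow> 'i set \<Rightarrow> (real ^ 'n) set" where
  "weight_lattice \<alpha> J = {\<Sum>j\<in>J. of_int (c j) *\<^sub>R fund_weight \<alpha> J j | c :: 'i \<Rightarrow> int. True}"

definition dominant_weights :: "('i \<Rightarrow> real ^ 'n) \<Rightarrow> 'i set \<Rightarrow> (real ^ 'n) set" where
  "dominant_weights \<alpha> J =
     {\<Sum>j\<in>J. of_int (c j) *\<^sub>R fund_weight \<alpha> J j | c :: 'i \<Rightarrow> int. \<forall>j\<in>J. 0 \<le> c j}"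

definition weyl_vector :: "('i \<Rightarrow> real ^ 'n) \<Rightarrow> 'i set \<Rightarrow> real ^ 'n" where
  "weyl_vector \<alpha> J = (\<Sum>j\<in>J. fund_weight \<alpha> J j)"

inductive_set weyl_group :: "(real ^ 'n) set \<Rightarrow> (real ^ 'n \<Rightarrow> real ^ 'n) set"
  for \<Phi> :: "(real ^ 'n) set" where
  id: "id \<in> weyl_group \<Phi>"
| refl: "w \<in> weyl_group \<Phi> \<Longrightarrow> a \<in> \<Phi> \<Longrightarrow> reflection a \<circ> w \<in> weyl_group \<Phi>"

section \<open>The group ring and Weyl bialternants\<close>

text \<open>Group rings of weight lattices are subrings of the group ring of the ambient space,
  i.e. of the finitely supported functions from \<^typ>\<open>real ^ 'n\<close> to \<^typ>\<open>int\<close> with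
  convolution product.\<close>

type_synonym 'n group_ring = "(real ^ 'n) \<Rightarrow>\<^sub>0 int"

abbreviation exp_basis :: "real ^ 'n \<Rightarrow> 'n group_ring" where
  "exp_basis \<mu> \<equiv> Poly_Mapping.single \<mu> 1"

definition lattice_ring :: "('i \<Rightarrow> real ^ 'n) \<Rightarrow> 'i set \<Rightarrow> 'n group_ring set" where
  "lattice_ring \<alpha> J = {f. Poly_Mapping.keys f \<subseteq> weight_lattice \<alpha> J}"

definition weyl_act :: "(real ^ 'n \<Rightarrow> real ^ 'n) \<Rightarrow> 'n group_ring \<Rightarrow> 'n group_ring" where
  "weyl_act w f =
     (\<Sum>\<mu>\<in>Poly_Mapping.keys f. Poly_Mapping.single (w \<mu>) (Poly_Mapping.lookup f \<mu>))"

definition weyl_invariant :: "(real ^ 'n) set \<Rightarrow> 'n group_ring \<Rightarrow> bool" where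
  "weyl_invariant \<Phi> f \<longleftrightarrow> (\<forall>w\<in>weyl_group \<Phi>. weyl_act w f = f)"

text \<open>The determinant of a Weyl group element is \<open>1\<close> or \<open>-1\<close>; the floor only changes its type.
  As the Weyl group fixes the orthogonal complement of \<^term>\<open>span \<Phi>\<close>, it does not matter
  that the determinant is taken on the ambient space.\<close>

definition alternant :: "(real ^ 'n) set \<Rightarrow> real ^ 'n \<Rightarrow> 'n group_ring" where
  "alternant \<Phi> \<mu> = (\<Sum>w\<in>weyl_group \<Phi>. Poly_Mapping.single (w \<mu>) \<lfloor>det (matrix w)\<rfloor>)"

definition bialternant ::
  "(real ^ 'n) set \<Rightarrow> ('i \<Rightarrow> real ^ 'n) \<Rightarrow> 'i set \<Rightarrow> real ^ 'n \<Rightarrow> 'n group_ring" where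
  "bialternant \<Phi> \<alpha> I \<mu> =
     (THE f. f \<in> lattice_ring \<alpha> I \<and>
        alternant \<Phi> (weyl_vector \<alpha> I) * f = alternant \<Phi> (\<mu> + weyl_vector \<alpha> I))"

text \<open>The restrictions \<open>\<mu> \<mapsto> \<mu>\<^sup>J\<close> and \<open>f \<mapsto> f|\<^sub>J\<close>. For \<open>j \<in> J\<close> the coefficient of the weight \<open>\<mu>\<close>
  at the \<open>j\<close>-th fundamental weight of \<open>\<Phi>\<close> is \<^term>\<open>\<mu> \<bullet> coroot (\<alpha> j)\<close>.\<close>

definition restrict_weight :: "('i \<Rightarrow> real ^ 'n) \<Rightarrow> 'i set \<Rightarrow> real ^ 'n \<Rightarrow> real ^ 'n" where
  "restrict_weight \<alpha> J \<mu> = (\<Sum>j\<in>J. (\<mu> \<bullet> coroot (\<alpha> j)) *\<^sub>R fund_weight \<alpha> J j)"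

definition restrict_ring :: "('i \<Rightarrow> real ^ 'n) \<Rightarrow> 'i set \<Rightarrow> 'n group_ring \<Rightarrow> 'n group_ring" where
  "restrict_ring \<alpha> J f =
     (\<Sum>\<mu>\<in>Poly_Mapping.keys f.
        Poly_Mapping.single (restrict_weight \<alpha> J \<mu>) (Poly_Mapping.lookup f \<mu>))"

section \<open>Ranked posets\<close>

definition covers :: "'p set \<Rightarrow> 'p rel \<Rightarrow> 'p rel" where
  "covers V r = {(s, t). s \<in> V \<and> t \<in> V \<and> s \<noteq> t \<and> (s, t) \<in> r \<and>
     (\<forall>u\<in>V. (s, u) \<in> r \<and> (u, t) \<in> r \<longrightarrow> u = s \<or> u = t)}"

definition rank_function :: "'p set \<Rightarrow> 'p rel \<Rightarrow> ('p \<Rightarrow> nat) \<Rightarrow> nat \<Rightarrow> bool" where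
  "rank_function V r \<rho> l \<longleftrightarrow> \<rho> ` V = {0..l} \<and> (\<forall>(s, t)\<in>covers V r. \<rho> s + 1 = \<rho> t)"

definition rank_symmetric :: "'p set \<Rightarrow> 'p rel \<Rightarrow> bool" where
  "rank_symmetric V r \<longleftrightarrow> (\<exists>\<rho> l. rank_function V r \<rho> l \<and>
     (\<forall>i\<in>{0..l}. card {x\<in>V. \<rho> x = i} = card {x\<in>V. \<rho> x = l - i}))"

definition symmetric_chain_decomposition ::
  "'p set \<Rightarrow> 'p rel \<Rightarrow> ('p \<Rightarrow> nat) \<Rightarrow> nat \<Rightarrow> 'p set set \<Rightarrow> bool" where
  "symmetric_chain_decomposition V r \<rho> l \<C> \<longleftrightarrow> partition_on V \<C> \<and>
     (\<forall>C\<in>\<C>. C \<in> Chains r \<and>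
       (\<exists>x\<in>C. \<exists>y\<in>C. (\<forall>z\<in>C. (x, z) \<in> r \<and> (z, y) \<in> r) \<and>
          \<rho> x + \<rho> y = l \<and> int (\<rho> y) - int (\<rho> x) = int (card C) - 1))"

section \<open>Edge-colored posets\<close>

text \<open>The value \<open>color P s t\<close> is only relevant if \<open>t\<close> covers \<open>s\<close>.\<close>

record ('p, 'i) colored_poset =
  elts :: "'p set"
  leq :: "'p rel"
  color :: "'p \<Rightarrow> 'p \<Rightarrow> 'i"

abbreviation hasse :: "('p, 'i) colored_poset \<Rightarrow> 'p rel" where
  "hasse P \<equiv> covers (elts P) (leq P)"

definition ranked_colored_poset :: "'i set \<Rightarrow> ('p, 'i) colored_poset \<Rightarrow> bool" where
  "ranked_colored_poset I P \<longleftrightarrow> finite (elts P) \<and> partial_order_on (elts P) (leq P) \<and>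
     (\<exists>\<rho> l. rank_function (elts P) (leq P) \<rho> l) \<and> (\<forall>(s, t)\<in>hasse P. color P s t \<in> I)"

definition edges :: "('p, 'i) colored_poset \<Rightarrow> 'i \<Rightarrow> 'p rel" where
  "edges P i = {(s, t)\<in>hasse P. color P s t = i}"

definition connected_by :: "'p rel \<Rightarrow> 'p rel" where
  "connected_by E = (E \<union> E\<inverse>)\<^sup>*"

definition color_comp :: "('p, 'i) colored_poset \<Rightarrow> 'i \<Rightarrow> 'p \<Rightarrow> 'p set" where
  "color_comp P i x = connected_by (edges P i) `` {x}"

text \<open>The \<open>i\<close>-component as a poset: its Hasse diagram consists of the edges of color \<open>i\<close> only, so
  its order may be weaker than the one induced by \<open>P\<close>.\<close>

definition comp_order :: "('p, 'i) colored_poset \<Rightarrow> 'i \<Rightarrow> 'p \<Rightarrow> 'p rel" where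
  "comp_order P i x = Restr ((edges P i)\<^sup>*) (color_comp P i x)"

text \<open>Components are connected, so a rank function on a component of a ranked poset is unique.\<close>

definition comp_rank :: "('p, 'i) colored_poset \<Rightarrow> 'i \<Rightarrow> 'p \<Rightarrow> nat" where
  "comp_rank P i x =
     (THE n. \<exists>\<rho> l. rank_function (color_comp P i x) (comp_order P i x) \<rho> l \<and> n = \<rho> x)"

definition comp_length :: "('p, 'i) colored_poset \<Rightarrow> 'i \<Rightarrow> 'p \<Rightarrow> nat" where
  "comp_length P i x =
     (THE l. \<exists>\<rho>. rank_function (color_comp P i x) (comp_order P i x) \<rho> l)"

definition comp_depth :: "('p, 'i) colored_poset \<Rightarrow> 'i \<Rightarrow> 'p \<Rightarrow> int" where
  "comp_depth P i x = int (comp_length P i x) - int (comp_rank P i x)"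

definition comp_mult :: "('p, 'i) colored_poset \<Rightarrow> 'i \<Rightarrow> 'p \<Rightarrow> int" where
  "comp_mult P i x = int (comp_rank P i x) - comp_depth P i x"

definition wt :: "('i \<Rightarrow> real ^ 'n) \<Rightarrow> 'i set \<Rightarrow> ('p, 'i) colored_poset \<Rightarrow> 'p \<Rightarrow> real ^ 'n" where
  "wt \<alpha> J P x = (\<Sum>j\<in>J. of_int (comp_mult P j x) *\<^sub>R fund_weight \<alpha> J j)"

definition WGF :: "('i \<Rightarrow> real ^ 'n) \<Rightarrow> 'i set \<Rightarrow> ('p, 'i) colored_poset \<Rightarrow> 'n group_ring" where
  "WGF \<alpha> I P = (\<Sum>x\<in>elts P. exp_basis (wt \<alpha> I P x))"

definition structured :: "('i \<Rightarrow> real ^ 'n) \<Rightarrow> 'i set \<Rightarrow> ('p, 'i) colored_poset \<Rightarrow> bool" where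
  "structured \<alpha> J P \<longleftrightarrow> (\<forall>j\<in>J. \<forall>(s, t)\<in>edges P j. wt \<alpha> J P s + \<alpha> j = wt \<alpha> J P t)"

definition splitting_poset ::
  "(real ^ 'n) set \<Rightarrow> ('i \<Rightarrow> real ^ 'n) \<Rightarrow> 'i set \<Rightarrow> 'i set \<Rightarrow> real ^ 'n \<Rightarrow>
   ('p, 'i) colored_poset \<Rightarrow> 'p set \<Rightarrow> bool" where
  "splitting_poset \<Phi> \<alpha> I J \<nu> P S \<longleftrightarrow>
     ranked_colored_poset I P \<and> structured \<alpha> I P \<and> S \<subseteq> elts P \<and>
     (\<forall>s\<in>S. \<nu> + wt \<alpha> J P s \<in> dominant_weights \<alpha> J) \<and>
     bialternant (subsystem \<Phi> \<alpha> J) \<alpha> J \<nu> * restrict_ring \<alpha> J (WGF \<alpha> I P) =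
       (\<Sum>s\<in>S. bialternant (subsystem \<Phi> \<alpha> J) \<alpha> J (\<nu> + wt \<alpha> J P s))"

section \<open>Kindred sets\<close>

definition kindred ::
  "('p, 'i) colored_poset \<Rightarrow> 'p set \<Rightarrow> ('p \<Rightarrow> 'i) \<Rightarrow> 'p \<Rightarrow> 'p set" where
  "kindred P S \<kappa> x = {y \<in> color_comp P (\<kappa> x) x. y \<in> elts P - S \<and> \<kappa> y = \<kappa> x}"

text \<open>The disjoint sum of the connected components of the subgraph of \<open>P\<close> (with edges of all
  colors) induced on the kindred set, each component with the order induced by
  \<open>color_comp P (\<kappa> x) x\<close>.\<close>

definition kindred_order ::
  "('p, 'i) colored_poset \<Rightarrow> 'p set \<Rightarrow> ('p \<Rightarrow> 'i) \<Rightarrow> 'p \<Rightarrow> 'p rel" where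
  "kindred_order P S \<kappa> x =
     Restr (comp_order P (\<kappa> x) x \<inter> connected_by (Restr (hasse P) (kindred P S \<kappa> x)))
       (kindred P S \<kappa> x)"

end

theory Submission
  imports Defs
begin

text \<open>The alternant of \<open>\<rho>\<close> is not a zero divisor, since \<open>\<rho>\<close> is its unique exponent with largest
  inner product with \<open>\<rho>\<close>. So the identity may be multiplied by it. By Weyl invariance it
  then says that the alternants of \<open>\<nu> + \<rho> + wt x\<close> with \<open>x \<notin> S\<close> add up to \<open>0\<close>. They do so on each
  chain of each kindred set of color \<open>k\<close>: the ranks of such a chain are symmetric about the point
  fixed by the reflection in \<open>\<alpha> k\<close>, which therefore reverses the chain and changes the sign of its
  alternants.\<close>

section \<open>Reflections and the Weyl group\<close>

text \<open>\<open>bialternant\<close> is a definite description, so nothing can be said about it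
  before each one is shown to exist and to be unique. Existence means that
  \<open>alternant \<Phi> (v + \<rho>)\<close> is divisible by
  \<open>alternant \<Phi> \<rho>\<close>. This divisibility and the cancellation of
  \<open>alternant \<Phi> \<rho>\<close> both rest on one fact: for dominant v and w in the Weyl
  group, \<open>v - w v\<close> is a nonnegative combination of simple roots. It is proved by
  induction on words in the simple reflections. The constant \<nu>_k + 1 in the hypotheses is the
  pairing of \<nu> + \<rho> with the coroot of \<alpha> k. A k-component of length l is a string of
  weights in direction \<alpha> k in which a vertex of rank t has pairing 2t - l. After the shift by
  \<nu> + \<rho>, the reflection in \<alpha> k sends position t to l - (\<nu>_k + 1) - t. This is
  why the chains have to be symmetric for the length l - (\<nu>_k + 1) and not for l.\<close>

lemma coroot_zero [simp]: "coroot 0 = 0"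
  by (simp add: coroot_def)

lemma inner_coroot_self: "a \<noteq> 0 \<Longrightarrow> a \<bullet> coroot a = 2"
  by (simp add: coroot_def)

lemma inner_coroot: "v \<bullet> coroot a = 2 * (v \<bullet> a) / (a \<bullet> a)"
  by (simp add: coroot_def)

lemma linear_reflection: "linear (reflection a)"
  unfolding reflection_def by (intro linearI) (simp_all add: algebra_simps inner_add_left)

lemma reflection_reflection [simp]: "reflection a (reflection a v) = v"
proof (cases "a = 0")
  case False
  then show ?thesis
    by (simp add: reflection_def inner_diff_left inner_coroot_self algebra_simps)
qed (simp add: reflection_def)

lemma reflection_self: "reflection a a = - a"
  by (cases "a = 0") (simp_all add: reflection_def inner_coroot_self scaleR_2)

lemma reflection_fixes: "v \<bullet> a = 0 \<Longrightarrow> reflection a v = v"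
  by (simp add: reflection_def inner_coroot)

lemma orthogonal_transformation_reflection: "orthogonal_transformation (reflection a)"
proof (cases "a = 0")
  case True
  then have "reflection a = (\<lambda>x. x)" by (auto simp: reflection_def)
  then show ?thesis by simp
next
  case False
  have "reflection a v \<bullet> reflection a w = v \<bullet> w" for v w
  proof -
    have "v \<bullet> coroot a * (a \<bullet> w) = w \<bullet> coroot a * (v \<bullet> a)"
      by (simp add: inner_coroot inner_commute)
    moreover have "v \<bullet> coroot a * (a \<bullet> a) = 2 * (v \<bullet> a)"
      using False by (simp add: inner_coroot)
    ultimately show ?thesis
      by (simp add: reflection_def inner_diff_left inner_diff_right algebra_simps)
  qed
  then show ?thesis by (simp add: orthogonal_transformation_def linear_reflection)
qed

lemma orthogonal_transformation_inner:
  "orthogonal_transformation f \<Longrightarrow> f v \<bullet> f w = v \<bullet> w"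
  by (simp add: orthogonal_transformation_def)

lemma reflection_conjugate:
  assumes "orthogonal_transformation f"
  shows "reflection (f a) (f v) = f (reflection a v)"
proof -
  have "linear f" using assms by (simp add: orthogonal_transformation_def)
  then show ?thesis
    by (simp add: reflection_def inner_coroot orthogonal_transformation_inner[OF assms]
        linear_diff linear_scale)
qed

section \<open>Determinants as integer signs\<close>

definition det_sign :: "(real ^ 'n \<Rightarrow> real ^ 'n) \<Rightarrow> int" where
  "det_sign w = \<lfloor>det (matrix w)\<rfloor>"

text \<open>The determinant is 1 or -1, so the floor loses nothing and real determinant identities
  transfer to integers.\<close>

lemma det_sign_of_int:
  assumes "orthogonal_transformation w"
  shows "of_int (det_sign w) = det (matrix w)"
proof -
  have "\<bar>det (matrix w)\<bar> = 1" using assms by simp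
  then have "det (matrix w) = 1 \<or> det (matrix w) = -1" by linarith
  then show ?thesis by (elim disjE) (simp_all add: det_sign_def)
qed

lemma det_sign_comp:
  assumes "orthogonal_transformation v" "orthogonal_transformation w"
  shows "det_sign (v \<circ> w) = det_sign v * det_sign w"
proof -
  have "(of_int (det_sign (v \<circ> w)) :: real) = of_int (det_sign v * det_sign w)"
    using assms det_mul[of "matrix v" "matrix w"]
    by (simp add: det_sign_of_int orthogonal_transformation_compose
        matrix_compose orthogonal_transformation_linear)
  then show ?thesis by linarith
qed

lemma det_sign_id [simp]: "det_sign id = 1"
  by (simp add: det_sign_def)

lemma det_reflection_axis:
  "det (matrix (reflection (axis k 1 :: real ^ 'n))) = -1"
proof -
  let ?A = "matrix (reflection (axis k 1 :: real ^ 'n))"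
  have A: "?A $ i $ j = (if i = j then if i = k then -1 else 1 else 0)" for i j
    by (simp add: matrix_def reflection_def inner_coroot inner_axis_axis) (simp add: axis_def)
  have "det ?A = (\<Prod>i\<in>UNIV. ?A $ i $ i)"
    by (intro det_diagonal) (simp add: A)
  also have "\<dots> = (\<Prod>i\<in>UNIV. if i = k then -1 else 1)" by (simp add: A)
  also have "\<dots> = -1" by (subst prod.delta) auto
  finally show ?thesis .
qed

text \<open>An orthogonal map that carries an axis vector of the same length to \<open>a\<close>
  conjugates one reflection into the other. The axis reflection has a diagonal matrix with a single
  entry -1.\<close>

lemma det_sign_reflection:
  fixes a :: "real ^ 'n"
  assumes "a \<noteq> 0"
  shows "det_sign (reflection a) = -1"
proof -
  \<comment> \<open>Any coordinate will do; this only names one.\<close>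
  obtain k :: 'n where True by simp
  let ?e = "axis k (norm a) :: real ^ 'n"
  have e0: "norm ?e = norm a" by (simp add: norm_eq_sqrt_inner inner_axis_axis)
  obtain f where f: "orthogonal_transformation f" "f ?e = a"
    using orthogonal_transformation_exists[OF e0] by blast
  have e: "reflection ?e = reflection (axis k 1)"
  proof -
    have "?e = norm a *\<^sub>R axis k 1" by (simp add: axis_def vec_eq_iff)
    then show ?thesis using assms
      by (simp add: fun_eq_iff reflection_def inner_coroot inner_axis_axis)
  qed
  have "reflection a \<circ> f = f \<circ> reflection (axis k 1)"
    using reflection_conjugate[OF f(1), of ?e] by (simp add: fun_eq_iff f(2) e)
  then have "det_sign (reflection a) * det_sign f = det_sign f * det_sign (reflection (axis k 1))"
    by (metis det_sign_comp f(1) orthogonal_transformation_reflection)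
  moreover have "det_sign (reflection (axis k 1 :: real ^ 'n)) = -1"
    using det_sign_of_int[OF orthogonal_transformation_reflection, of "axis k 1 :: real ^ 'n"]
    by (simp add: det_reflection_axis)
  moreover have "det_sign f \<noteq> 0"
    using det_sign_of_int[OF f(1)] orthogonal_transformation_det[OF f(1)] by auto
  ultimately show ?thesis by (metis mult.commute mult_cancel_right)
qed

section \<open>The Weyl group as a finite group of orthogonal maps\<close>

lemma weyl_group_orthogonal: "w \<in> weyl_group \<Phi> \<Longrightarrow> orthogonal_transformation w"
  by (induction rule: weyl_group.induct)
     (simp_all add: id_def orthogonal_transformation_compose
       orthogonal_transformation_reflection del: o_apply)

lemma weyl_group_linear: "w \<in> weyl_group \<Phi> \<Longrightarrow> linear w"
  by (simp add: weyl_group_orthogonal orthogonal_transformation_linear)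

lemma weyl_group_inner: "w \<in> weyl_group \<Phi> \<Longrightarrow> w u \<bullet> w v = u \<bullet> v"
  by (simp add: weyl_group_orthogonal orthogonal_transformation_inner)

lemma weyl_group_comp:
  "v \<in> weyl_group \<Phi> \<Longrightarrow> w \<in> weyl_group \<Phi> \<Longrightarrow> v \<circ> w \<in> weyl_group \<Phi>"
  by (induction rule: weyl_group.induct) (auto simp: comp_assoc intro: weyl_group.intros)

lemma weyl_group_reflection: "a \<in> \<Phi> \<Longrightarrow> reflection a \<in> weyl_group \<Phi>"
  using weyl_group.refl[OF weyl_group.id] by simp

text \<open>The inductive definition has no rule for inverses; they arise by multiplying the
  reflections in reverse order.\<close>

lemma weyl_group_inverse:
  "w \<in> weyl_group \<Phi> \<Longrightarrow> \<exists>v\<in>weyl_group \<Phi>. v \<circ> w = id \<and> w \<circ> v = id"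
proof (induction rule: weyl_group.induct)
  case id
  then show ?case by (intro bexI[OF _ weyl_group.id]) simp
next
  case (refl w a)
  then obtain v where v: "v \<in> weyl_group \<Phi>" "v \<circ> w = id" "w \<circ> v = id" by blast
  then have "v \<circ> reflection a \<in> weyl_group \<Phi>"
    using refl by (simp add: weyl_group_comp weyl_group_reflection)
  moreover have "(v \<circ> reflection a) \<circ> (reflection a \<circ> w) = id"
    "(reflection a \<circ> w) \<circ> (v \<circ> reflection a) = id"
    using v by (simp_all add: fun_eq_iff)
  ultimately show ?case by blast
qed

lemma weyl_group_bij: "w \<in> weyl_group \<Phi> \<Longrightarrow> bij w"
  by (simp add: weyl_group_orthogonal orthogonal_transformation_bij)

lemma weyl_group_comp_bij_left:
  assumes "v \<in> weyl_group \<Phi>"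
  shows "bij_betw (\<lambda>w. v \<circ> w) (weyl_group \<Phi>) (weyl_group \<Phi>)"
proof -
  obtain u where u: "u \<in> weyl_group \<Phi>" "u \<circ> v = id" "v \<circ> u = id"
    using weyl_group_inverse[OF assms] by auto
  show ?thesis
    by (rule bij_betw_byWitness[where f' = "\<lambda>w. u \<circ> w"])
       (use u assms in \<open>auto simp: comp_assoc[symmetric] intro: weyl_group_comp\<close>)
qed

lemma weyl_group_comp_bij_right:
  assumes "v \<in> weyl_group \<Phi>"
  shows "bij_betw (\<lambda>w. w \<circ> v) (weyl_group \<Phi>) (weyl_group \<Phi>)"
proof -
  obtain u where u: "u \<in> weyl_group \<Phi>" "u \<circ> v = id" "v \<circ> u = id"
    using weyl_group_inverse[OF assms] by auto
  show ?thesis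
    by (rule bij_betw_byWitness[where f' = "\<lambda>w. w \<circ> u"])
       (use u assms in \<open>auto simp: comp_assoc intro: weyl_group_comp\<close>)
qed

lemma weyl_group_root:
  assumes "root_system \<Phi>" "w \<in> weyl_group \<Phi>" "a \<in> \<Phi>"
  shows "w a \<in> \<Phi>"
  using assms(2,3) by induction (use assms(1) in \<open>auto simp: root_system_def\<close>)

lemma weyl_group_fixes_orthogonal:
  assumes "w \<in> weyl_group \<Phi>" "\<And>a. a \<in> \<Phi> \<Longrightarrow> v \<bullet> a = 0"
  shows "w v = v"
  using assms(1) by induction (auto simp: reflection_fixes assms(2))

text \<open>A Weyl group element is determined by the permutation of the roots that it induces, since
  it fixes the orthogonal complement of the roots.\<close>

lemma finite_weyl_group:
  assumes "root_system \<Phi>"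
  shows "finite (weyl_group \<Phi>)"
proof (rule inj_on_finite)
  show "finite (\<Phi> \<rightarrow>\<^sub>E \<Phi>)"
    using assms by (intro finite_PiE) (auto simp: root_system_def)
  show "(\<lambda>w. restrict w \<Phi>) ` weyl_group \<Phi> \<subseteq> \<Phi> \<rightarrow>\<^sub>E \<Phi>"
    using weyl_group_root[OF assms] by auto
  show "inj_on (\<lambda>w. restrict w \<Phi>) (weyl_group \<Phi>)"
  proof (rule inj_onI, rule ext)
    fix v w x assume vw: "v \<in> weyl_group \<Phi>" "w \<in> weyl_group \<Phi>" "restrict v \<Phi> = restrict w \<Phi>"
    obtain y z where yz: "y \<in> span \<Phi>" "\<And>u. u \<in> span \<Phi> \<Longrightarrow> orthogonal z u" "x = y + z"
      using orthogonal_subspace_decomp_exists[of \<Phi> x] by metis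
    have "v a = w a" if "a \<in> \<Phi>" for a
      using vw(3) that by (metis restrict_apply)
    then have "v y = w y"
      using linear_eq_on[OF weyl_group_linear[OF vw(1)] weyl_group_linear[OF vw(2)] yz(1)] by simp
    moreover have "v z = z" "w z = z"
      using yz(2) vw by (auto intro!: weyl_group_fixes_orthogonal simp: orthogonal_def span_base)
    ultimately show "v x = w x"
      by (simp add: yz(3) linear_add[OF weyl_group_linear[OF vw(1)]]
          linear_add[OF weyl_group_linear[OF vw(2)]])
  qed
qed

section \<open>Systems of simple roots\<close>

text \<open>Serves both \<open>\<Phi>\<close> with index set I and the subsystem with index set
  J.\<close>

locale simple_system =
  fixes \<Phi> :: "(real ^ 'n) set" and \<alpha> :: "'i \<Rightarrow> real ^ 'n" and J :: "'i set"
  assumes root_system: "root_system \<Phi>" and simple_roots: "simple_roots \<Phi> \<alpha> J"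
begin

lemma finite_roots: "finite \<Phi>"
  using root_system by (simp add: root_system_def)

lemma simple_root: "j \<in> J \<Longrightarrow> \<alpha> j \<in> \<Phi>"
  using simple_roots by (auto simp: simple_roots_def)

lemma root_nonzero: "a \<in> \<Phi> \<Longrightarrow> a \<noteq> 0"
  using root_system by (auto simp: root_system_def)

lemma simple_root_nonzero: "j \<in> J \<Longrightarrow> \<alpha> j \<noteq> 0"
  by (simp add: root_nonzero simple_root)

lemma finite_index: "finite J"
  using simple_roots finite_roots unfolding simple_roots_def
  by (meson finite_imageD finite_subset)

text \<open>Independence concerns the set of simple roots; injectivity of \<alpha> carries it over
  to indexed families.\<close>

lemma coeff_eq_0:
  assumes "(\<Sum>i\<in>J. c i *\<^sub>R \<alpha> i) = 0" "i \<in> J"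
  shows "c i = 0"
proof -
  have inj: "inj_on \<alpha> J" and ind: "independent (\<alpha> ` J)"
    using simple_roots by (auto simp: simple_roots_def)
  have "(\<Sum>v\<in>\<alpha> ` J. c (the_inv_into J \<alpha> v) *\<^sub>R v) = (\<Sum>i\<in>J. c i *\<^sub>R \<alpha> i)"
    by (simp add: sum.reindex[OF inj] the_inv_into_f_f[OF inj])
  then have "c (the_inv_into J \<alpha> (\<alpha> i)) = 0"
    using assms by (intro independentD[OF ind, of "\<alpha> ` J"]) (auto simp: finite_index)
  then show ?thesis using assms(2) by (simp add: the_inv_into_f_f[OF inj])
qed

lemma coeff_unique:
  assumes "(\<Sum>i\<in>J. c i *\<^sub>R \<alpha> i) = (\<Sum>i\<in>J. d i *\<^sub>R \<alpha> i)" "i \<in> J"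
  shows "c i = d i"
  using coeff_eq_0[of "\<lambda>i. c i - d i" i] assms
  by (simp add: scaleR_diff_left sum_subtractf)

lemma simple_root_in_span: "j \<in> J \<Longrightarrow> \<alpha> j \<in> span (\<alpha> ` J)"
  by (simp add: span_base)

lemma inner_coroot_pos_iff: "j \<in> J \<Longrightarrow> v \<bullet> coroot (\<alpha> j) > 0 \<longleftrightarrow> v \<bullet> \<alpha> j > 0"
  by (simp add: inner_coroot simple_root_nonzero zero_less_divide_iff)
     (meson inner_gt_zero_iff less_asym simple_root_nonzero)

lemma inner_coroot_nonneg_iff: "j \<in> J \<Longrightarrow> v \<bullet> coroot (\<alpha> j) \<ge> 0 \<longleftrightarrow> v \<bullet> \<alpha> j \<ge> 0"
  using inner_coroot_pos_iff[of j "-v"] by simp linarith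

subsection \<open>Fundamental weights\<close>

text \<open>The difference lies in the span and is orthogonal to every simple root, hence to
  itself.\<close>

lemma span_eqI:
  assumes "u \<in> span (\<alpha> ` J)" "v \<in> span (\<alpha> ` J)"
    and "\<And>k. k \<in> J \<Longrightarrow> u \<bullet> coroot (\<alpha> k) = v \<bullet> coroot (\<alpha> k)"
  shows "u = v"
proof -
  have "orthogonal (u - v) a" if "a \<in> \<alpha> ` J" for a
    using that assms(3) simple_root_nonzero
    by (auto simp: orthogonal_def inner_coroot inner_diff_left)
  then have "orthogonal (u - v) (u - v)"
    using assms by (intro orthogonal_to_span[of "u - v" "\<alpha> ` J"]) (auto intro: span_diff)
  then show ?thesis by (simp add: orthogonal_self)
qed

text \<open>Up to scaling, the weight is the component z of \<alpha> j orthogonal to the other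
  simple roots, which is nonzero by independence.\<close>

lemma fund_weight_exists:
  assumes "j \<in> J"
  shows "\<exists>v. v \<in> span (\<alpha> ` J) \<and> (\<forall>k\<in>J. v \<bullet> coroot (\<alpha> k) = (if k = j then 1 else 0))"
proof -
  have inj: "inj_on \<alpha> J" and ind: "independent (\<alpha> ` J)"
    using simple_roots by (auto simp: simple_roots_def)
  obtain y z where yz: "y \<in> span (\<alpha> ` (J - {j}))"
    "\<And>w. w \<in> span (\<alpha> ` (J - {j})) \<Longrightarrow> orthogonal z w" "\<alpha> j = y + z"
    using orthogonal_subspace_decomp_exists[of "\<alpha> ` (J - {j})" "\<alpha> j"] by metis
  have "\<alpha> ` (J - {j}) = \<alpha> ` J - {\<alpha> j}" using inj assms by (auto simp: inj_on_def)
  then have "\<alpha> j \<notin> span (\<alpha> ` (J - {j}))"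
    using ind assms unfolding dependent_def by (metis imageI)
  then have z0: "z \<noteq> 0" using yz by auto
  have "y \<in> span (\<alpha> ` J)" using yz(1) span_mono[of "\<alpha> ` (J - {j})" "\<alpha> ` J"] by auto
  then have "z \<in> span (\<alpha> ` J)"
    using span_diff[OF simple_root_in_span[OF assms], of y] yz(3) by simp
  moreover have "z \<bullet> \<alpha> j = z \<bullet> z"
    using yz(2)[OF yz(1)] by (simp add: yz(3) inner_add_right orthogonal_def)
  moreover have "z \<bullet> \<alpha> k = 0" if "k \<in> J" "k \<noteq> j" for k
    using yz(2)[of "\<alpha> k"] that by (simp add: span_base orthogonal_def)
  \<comment> \<open>Since \<open>z \<bullet> \<alpha> j = z \<bullet> z\<close>, the pairing of z
    with the coroot of \<alpha> j is
    \<open>2 * (z \<bullet> z) / (\<alpha> j \<bullet> \<alpha> j)\<close>; the witness divides by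
    it.\<close>
  ultimately show ?thesis
    using z0 simple_root_nonzero[OF assms]
    by (intro exI[of _ "((\<alpha> j \<bullet> \<alpha> j) / (2 * (z \<bullet> z))) *\<^sub>R z"])
       (auto simp: inner_coroot intro: span_scale)
qed

lemma fund_weight:
  assumes "j \<in> J"
  shows "fund_weight \<alpha> J j \<in> span (\<alpha> ` J)"
    and "k \<in> J \<Longrightarrow> fund_weight \<alpha> J j \<bullet> coroot (\<alpha> k) = (if k = j then 1 else 0)"
proof -
  have "\<exists>!v. v \<in> span (\<alpha> ` J) \<and> (\<forall>k\<in>J. v \<bullet> coroot (\<alpha> k) = (if k = j then 1 else 0))"
    using fund_weight_exists[OF assms] span_eqI by (metis (no_types, lifting))
  from theI'[OF this]
  show "fund_weight \<alpha> J j \<in> span (\<alpha> ` J)"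
    and "k \<in> J \<Longrightarrow> fund_weight \<alpha> J j \<bullet> coroot (\<alpha> k) = (if k = j then 1 else 0)"
    by (auto simp: fund_weight_def)
qed

lemma fund_weight_combination_coeff:
  assumes "k \<in> J"
  shows "(\<Sum>j\<in>J. c j *\<^sub>R fund_weight \<alpha> J j) \<bullet> coroot (\<alpha> k) = c k"
proof -
  have "(\<Sum>j\<in>J. c j *\<^sub>R fund_weight \<alpha> J j) \<bullet> coroot (\<alpha> k) = (\<Sum>j\<in>J. if j = k then c j else 0)"
    unfolding inner_sum_left using fund_weight(2) assms by (intro sum.cong) auto
  then show ?thesis using assms finite_index by simp
qed

lemma fund_weight_combination_in_span:
  "(\<Sum>j\<in>J. c j *\<^sub>R fund_weight \<alpha> J j) \<in> span (\<alpha> ` J)"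
  by (intro span_sum span_scale fund_weight(1))

lemma fund_weight_expansion:
  "v \<in> span (\<alpha> ` J) \<Longrightarrow> (\<Sum>j\<in>J. (v \<bullet> coroot (\<alpha> j)) *\<^sub>R fund_weight \<alpha> J j) = v"
  by (intro span_eqI)
     (auto simp: fund_weight_combination_coeff fund_weight_combination_in_span)

text \<open>A description by pairings, from which closure under sums and reflections follows
  directly.\<close>

lemma weight_lattice_iff:
  "v \<in> weight_lattice \<alpha> J \<longleftrightarrow> v \<in> span (\<alpha> ` J) \<and> (\<forall>j\<in>J. v \<bullet> coroot (\<alpha> j) \<in> \<int>)"
proof
  assume "v \<in> weight_lattice \<alpha> J"
  then show "v \<in> span (\<alpha> ` J) \<and> (\<forall>j\<in>J. v \<bullet> coroot (\<alpha> j) \<in> \<int>)"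
    by (auto simp: weight_lattice_def fund_weight_combination_coeff
        fund_weight_combination_in_span)
next
  assume v: "v \<in> span (\<alpha> ` J) \<and> (\<forall>j\<in>J. v \<bullet> coroot (\<alpha> j) \<in> \<int>)"
  then have "v = (\<Sum>j\<in>J. of_int \<lfloor>v \<bullet> coroot (\<alpha> j)\<rfloor> *\<^sub>R fund_weight \<alpha> J j)"
    by (subst fund_weight_expansion[symmetric]) (auto intro!: sum.cong)
  then show "v \<in> weight_lattice \<alpha> J"
    unfolding weight_lattice_def mem_Collect_eq by (intro exI[of _ "\<lambda>j. \<lfloor>v \<bullet> coroot (\<alpha> j)\<rfloor>"]) simp
qed

lemma dominant_weights_iff:
  "v \<in> dominant_weights \<alpha> J \<longleftrightarrow> v \<in> weight_lattice \<alpha> J \<and> (\<forall>j\<in>J. 0 \<le> v \<bullet> coroot (\<alpha> j))"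
proof
  assume "v \<in> dominant_weights \<alpha> J"
  then show "v \<in> weight_lattice \<alpha> J \<and> (\<forall>j\<in>J. 0 \<le> v \<bullet> coroot (\<alpha> j))"
    by (auto simp: dominant_weights_def weight_lattice_def fund_weight_combination_coeff)
next
  assume v: "v \<in> weight_lattice \<alpha> J \<and> (\<forall>j\<in>J. 0 \<le> v \<bullet> coroot (\<alpha> j))"
  then obtain c :: "'i \<Rightarrow> int" where c: "v = (\<Sum>j\<in>J. of_int (c j) *\<^sub>R fund_weight \<alpha> J j)"
    by (auto simp: weight_lattice_def)
  then have "\<forall>j\<in>J. 0 \<le> c j" using v by (auto simp: fund_weight_combination_coeff)
  then show "v \<in> dominant_weights \<alpha> J"
    using c unfolding dominant_weights_def mem_Collect_eq by (intro exI[of _ c]) simp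
qed

lemma weight_lattice_add:
  "u \<in> weight_lattice \<alpha> J \<Longrightarrow> v \<in> weight_lattice \<alpha> J \<Longrightarrow> u + v \<in> weight_lattice \<alpha> J"
  by (simp add: weight_lattice_iff span_add inner_add_left)

lemma weight_lattice_diff:
  "u \<in> weight_lattice \<alpha> J \<Longrightarrow> v \<in> weight_lattice \<alpha> J \<Longrightarrow> u - v \<in> weight_lattice \<alpha> J"
  by (simp add: weight_lattice_iff span_diff inner_diff_left)

lemma weyl_vector_coroot: "j \<in> J \<Longrightarrow> weyl_vector \<alpha> J \<bullet> coroot (\<alpha> j) = 1"
  using fund_weight_combination_coeff[of j "\<lambda>_. 1"] by (simp add: weyl_vector_def)

lemma weyl_vector_weight: "weyl_vector \<alpha> J \<in> weight_lattice \<alpha> J"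
  using fund_weight_combination_in_span[of "\<lambda>_. 1"]
  by (simp add: weight_lattice_iff weyl_vector_coroot) (simp add: weyl_vector_def)

lemma weyl_vector_pos: "j \<in> J \<Longrightarrow> \<alpha> j \<bullet> weyl_vector \<alpha> J > 0"
  using inner_coroot_pos_iff[of j "weyl_vector \<alpha> J"]
  by (simp add: weyl_vector_coroot inner_commute[of _ "weyl_vector \<alpha> J"])

subsection \<open>The cone of positive roots\<close>

text \<open>Membership of \<open>u - v\<close> is the dominance order. The coefficients are real
  because the order is also used for vectors that need not be weights.\<close>

definition root_cone :: "(real ^ 'n) set" where
  "root_cone = {\<Sum>i\<in>J. c i *\<^sub>R \<alpha> i | c. \<forall>i\<in>J. 0 \<le> c i}"

lemma root_cone_add: "u \<in> root_cone \<Longrightarrow> v \<in> root_cone \<Longrightarrow> u + v \<in> root_cone"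
proof -
  assume "u \<in> root_cone" "v \<in> root_cone"
  then obtain c d where "u = (\<Sum>i\<in>J. c i *\<^sub>R \<alpha> i)" "\<forall>i\<in>J. 0 \<le> c i"
    "v = (\<Sum>i\<in>J. d i *\<^sub>R \<alpha> i)" "\<forall>i\<in>J. 0 \<le> d i"
    by (auto simp: root_cone_def)
  then show ?thesis unfolding root_cone_def mem_Collect_eq
    by (intro exI[of _ "\<lambda>i. c i + d i"]) (simp add: scaleR_add_left sum.distrib)
qed

lemma root_cone_scale: "u \<in> root_cone \<Longrightarrow> 0 \<le> t \<Longrightarrow> t *\<^sub>R u \<in> root_cone"
proof -
  assume "u \<in> root_cone" "0 \<le> t"
  then obtain c where "u = (\<Sum>i\<in>J. c i *\<^sub>R \<alpha> i)" "\<forall>i\<in>J. 0 \<le> c i"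
    by (auto simp: root_cone_def)
  then show ?thesis using \<open>0 \<le> t\<close> unfolding root_cone_def mem_Collect_eq
    by (intro exI[of _ "\<lambda>i. t * c i"]) (simp add: scaleR_sum_right)
qed

lemma zero_in_root_cone: "0 \<in> root_cone"
  unfolding root_cone_def mem_Collect_eq by (intro exI[of _ "\<lambda>_. 0"]) simp

lemma simple_root_in_root_cone:
  assumes "j \<in> J"
  shows "\<alpha> j \<in> root_cone"
proof -
  have "\<alpha> j = (\<Sum>i\<in>J. (if i = j then 1 else 0) *\<^sub>R \<alpha> i)"
    using assms finite_index by (simp add: if_distrib[of "\<lambda>x. x *\<^sub>R _"] cong: if_cong)
  then show ?thesis unfolding root_cone_def mem_Collect_eq
    by (intro exI[of _ "\<lambda>i. if i = j then 1 else 0"]) auto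
qed

lemma root_in_root_cone: "a \<in> \<Phi> \<Longrightarrow> a \<in> root_cone \<or> - a \<in> root_cone"
proof -
  assume "a \<in> \<Phi>"
  then obtain c :: "'i \<Rightarrow> int" where c: "a = (\<Sum>i\<in>J. of_int (c i) *\<^sub>R \<alpha> i)"
    "(\<forall>i\<in>J. 0 \<le> c i) \<or> (\<forall>i\<in>J. c i \<le> 0)"
    using simple_roots unfolding simple_roots_def by blast
  from c(2) show ?thesis
  proof
    assume "\<forall>i\<in>J. 0 \<le> c i"
    then show ?thesis using c(1) unfolding root_cone_def mem_Collect_eq
      by (intro disjI1 exI[of _ "\<lambda>i. of_int (c i)"]) simp
  next
    assume "\<forall>i\<in>J. c i \<le> 0"
    then show ?thesis using c(1) unfolding root_cone_def mem_Collect_eq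
      by (intro disjI2 exI[of _ "\<lambda>i. - of_int (c i)"]) (simp add: sum_negf)
  qed
qed

lemma dominant_inner_root_cone:
  assumes "\<And>j. j \<in> J \<Longrightarrow> 0 \<le> v \<bullet> \<alpha> j" "u \<in> root_cone"
  shows "0 \<le> u \<bullet> v"
  using assms
  by (auto simp: root_cone_def inner_sum_right inner_commute[of _ v] intro!: sum_nonneg)

lemma weyl_vector_inner_simple_root: "j \<in> J \<Longrightarrow> 0 < weyl_vector \<alpha> J \<bullet> \<alpha> j"
  by (subst inner_commute) (rule weyl_vector_pos)

lemma weyl_vector_inner_root_cone: "u \<in> root_cone \<Longrightarrow> 0 \<le> u \<bullet> weyl_vector \<alpha> J"
  by (rule dominant_inner_root_cone[OF less_imp_le[OF weyl_vector_inner_simple_root]])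

text \<open>Pairing with the Weyl vector is strictly positive on each simple root, so it acts as a
  height on the cone.\<close>

lemma root_cone_eq_0:
  assumes "u \<in> root_cone" "u \<bullet> weyl_vector \<alpha> J = 0"
  shows "u = 0"
proof -
  obtain c where c: "u = (\<Sum>i\<in>J. c i *\<^sub>R \<alpha> i)" "\<forall>i\<in>J. 0 \<le> c i"
    using assms(1) by (auto simp: root_cone_def)
  have "(\<Sum>i\<in>J. c i * (\<alpha> i \<bullet> weyl_vector \<alpha> J)) = 0"
    using assms(2) by (simp add: c(1) inner_sum_left)
  moreover have "0 \<le> c i * (\<alpha> i \<bullet> weyl_vector \<alpha> J)" if "i \<in> J" for i
    using that c(2) weyl_vector_pos[OF that] by simp
  ultimately have "\<forall>i\<in>J. c i * (\<alpha> i \<bullet> weyl_vector \<alpha> J) = 0"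
    using sum_nonneg_eq_0_iff[OF finite_index] by (metis (no_types, lifting))
  then have "c i = 0" if "i \<in> J" for i using weyl_vector_pos[OF that] that by auto
  then show ?thesis by (simp add: c(1))
qed

text \<open>The reflection alters only the coefficient at j. Some other coefficient is positive and
  survives, and all coefficients of a root have the same sign.\<close>

lemma simple_reflection_root_cone:
  assumes "j \<in> J" "b \<in> \<Phi>" "b \<in> root_cone" "b \<noteq> \<alpha> j"
  shows "reflection (\<alpha> j) b \<in> root_cone"
proof -
  obtain c where c: "b = (\<Sum>i\<in>J. c i *\<^sub>R \<alpha> i)" "\<forall>i\<in>J. 0 \<le> c i"
    using assms(3) by (auto simp: root_cone_def)
  have split: "(\<Sum>i\<in>J. d i *\<^sub>R \<alpha> i) = d j *\<^sub>R \<alpha> j + (\<Sum>i\<in>J-{j}. d i *\<^sub>R \<alpha> i)" for d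
    using finite_index assms(1) by (rule sum.remove)
  \<comment> \<open>Here the root system being reduced matters: a root supported on j alone is
    \<alpha> j or its negative.\<close>
  have "\<exists>k\<in>J-{j}. c k \<noteq> 0"
  proof (rule ccontr)
    assume "\<not> (\<exists>k\<in>J-{j}. c k \<noteq> 0)"
    then have "b = c j *\<^sub>R \<alpha> j" using c(1) split[of c] by simp
    moreover from this have "c j = 1 \<or> c j = -1"
      using root_system assms(1,2) simple_root unfolding root_system_def by blast
    ultimately show False using c(2) assms(1,4) by auto
  qed
  then obtain k where k: "k \<in> J" "k \<noteq> j" "0 < c k"
    using c(2) by (metis Diff_iff insertI1 order_less_le)
  define d where "d i = (if i = j then c i - b \<bullet> coroot (\<alpha> j) else c i)" for i
  have d: "reflection (\<alpha> j) b = (\<Sum>i\<in>J. d i *\<^sub>R \<alpha> i)"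
  proof -
    have "(\<Sum>i\<in>J-{j}. d i *\<^sub>R \<alpha> i) = (\<Sum>i\<in>J-{j}. c i *\<^sub>R \<alpha> i)"
      by (intro sum.cong) (auto simp: d_def)
    moreover have "b = c j *\<^sub>R \<alpha> j + (\<Sum>i\<in>J-{j}. c i *\<^sub>R \<alpha> i)"
      using split[of c] c(1) by simp
    ultimately show ?thesis
      by (simp add: split[of d] reflection_def) (simp add: d_def scaleR_diff_left)
  qed
  have "reflection (\<alpha> j) b \<in> \<Phi>"
    using root_system assms(1,2) simple_root by (auto simp: root_system_def)
  then consider "reflection (\<alpha> j) b \<in> root_cone" | "- reflection (\<alpha> j) b \<in> root_cone"
    using root_in_root_cone by blast
  then show ?thesis
  proof cases
    case 2
    then obtain e where e: "- reflection (\<alpha> j) b = (\<Sum>i\<in>J. e i *\<^sub>R \<alpha> i)" "\<forall>i\<in>J. 0 \<le> e i"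
      by (auto simp: root_cone_def)
    then have "(\<Sum>i\<in>J. (- e i) *\<^sub>R \<alpha> i) = (\<Sum>i\<in>J. d i *\<^sub>R \<alpha> i)"
      by (simp add: d sum_negf) (metis minus_minus)
    then have "- e k = d k" using k(1) by (rule coeff_unique)
    then show ?thesis using k e(2) by (auto simp: d_def)
  qed
qed

subsection \<open>Words in the simple reflections\<close>

text \<open>Words make a length available for induction, which membership in
  \<open>weyl_group\<close> does not record.\<close>

definition word :: "'i list \<Rightarrow> real ^ 'n \<Rightarrow> real ^ 'n" where
  "word js = foldr (\<lambda>j w. reflection (\<alpha> j) \<circ> w) js id"

lemma word_Nil [simp]: "word [] = id"
  and word_Cons [simp]: "word (j # js) = reflection (\<alpha> j) \<circ> word js"
  by (simp_all add: word_def)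

lemma word_append [simp]: "word (js @ ks) = word js \<circ> word ks"
  by (induction js) (simp_all add: comp_assoc)

lemma word_rev [simp]: "word (rev js) \<circ> word js = id"
proof (induction js)
  case (Cons j js)
  have "word (rev (j # js)) \<circ> word (j # js) = word (rev js) \<circ> word js"
    by (simp add: fun_eq_iff)
  then show ?case using Cons by (simp only:)
qed simp

lemma word_in_weyl_group: "js \<in> lists J \<Longrightarrow> word js \<in> weyl_group \<Phi>"
  by (induction js) (auto intro: weyl_group.intros simp: simple_root simp del: o_apply)

text \<open>A positive root is moved to a simple root by lowering its height with simple
  reflections. The reflections in the two roots are then conjugate by a word. A negative root has
  the same reflection as its opposite.\<close>

lemma reflection_word:
  assumes "a \<in> \<Phi>"
  shows "\<exists>js\<in>lists J. reflection a = word js"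
proof -
  have pos: "\<exists>js\<in>lists J. reflection a = word js" if a: "a \<in> \<Phi>" "a \<in> root_cone" for a
  proof -
    \<comment> \<open>The positive roots reachable from a by words; b is one of least
      height.\<close>
    define X where "X = {b \<in> \<Phi> \<inter> root_cone. \<exists>js\<in>lists J. b = word js a}"
    have "finite X" unfolding X_def by (simp add: finite_roots)
    moreover have "a \<in> X" using a by (auto simp: X_def intro!: bexI[of _ "[]"])
    ultimately obtain b where b: "b \<in> X"
      "\<And>b'. b' \<in> X \<Longrightarrow> b \<bullet> weyl_vector \<alpha> J \<le> b' \<bullet> weyl_vector \<alpha> J"
      using arg_min_if_finite(1)[of X "\<lambda>b. b \<bullet> weyl_vector \<alpha> J"]
        arg_min_least[of X _ "\<lambda>b. b \<bullet> weyl_vector \<alpha> J"] by (metis empty_iff)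
    obtain js where js: "js \<in> lists J" "b = word js a" using b(1) by (auto simp: X_def)
    obtain c where c: "b = (\<Sum>i\<in>J. c i *\<^sub>R \<alpha> i)" "\<forall>i\<in>J. 0 \<le> c i"
      using b(1) by (auto simp: X_def root_cone_def)
    \<comment> \<open>Otherwise expanding one factor of \<open>b \<bullet> b\<close> in simple roots
      would make it nonpositive.\<close>
    have "\<exists>j\<in>J. b \<bullet> \<alpha> j > 0"
    proof (rule ccontr)
      assume "\<not> ?thesis"
      then have "(\<Sum>i\<in>J. c i * (b \<bullet> \<alpha> i)) \<le> 0"
        using c(2) by (intro sum_nonpos) (auto simp: not_less mult_nonneg_nonpos)
      moreover have "b \<bullet> b = (\<Sum>i\<in>J. c i * (b \<bullet> \<alpha> i))"
        by (subst (2) c(1)) (simp add: inner_sum_right)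
      moreover have "b \<bullet> b > 0" using b(1) root_nonzero by (auto simp: X_def)
      ultimately show False by simp
    qed
    then obtain j where j: "j \<in> J" "b \<bullet> \<alpha> j > 0" by blast
    \<comment> \<open>If not, the reflection in \<alpha> j would keep b positive and lower its
      height, against minimality.\<close>
    have "b = \<alpha> j"
    proof (rule ccontr)
      assume "b \<noteq> \<alpha> j"
      then have "reflection (\<alpha> j) b \<in> X"
        using b(1) j(1) js simple_reflection_root_cone[of j b] root_system simple_root
        by (auto simp: X_def root_system_def intro!: bexI[of _ "j # js"])
      then have "b \<bullet> weyl_vector \<alpha> J \<le> reflection (\<alpha> j) b \<bullet> weyl_vector \<alpha> J" by (rule b(2))
      moreover have "0 < (b \<bullet> coroot (\<alpha> j)) * (\<alpha> j \<bullet> weyl_vector \<alpha> J)"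
        using j weyl_vector_pos inner_coroot_pos_iff by simp
      ultimately show False by (simp add: reflection_def inner_diff_left)
    qed
    have "reflection (\<alpha> j) \<circ> word js = word js \<circ> reflection a"
      using reflection_conjugate[OF weyl_group_orthogonal[OF word_in_weyl_group[OF js(1)]]]
        js(2) \<open>b = \<alpha> j\<close> by (simp add: fun_eq_iff)
    then have "word (rev js) \<circ> (reflection (\<alpha> j) \<circ> word js) = reflection a"
      by (simp add: comp_assoc[symmetric] del: o_apply)
    then have "reflection a = word (rev js @ j # js)" by (simp add: comp_assoc)
    then show ?thesis using js(1) j(1)
      by (intro bexI[of _ "rev js @ j # js"]) (auto simp: lists_eq_set)
  qed
  have neg: "reflection (- a) = reflection a"
    by (simp add: fun_eq_iff reflection_def inner_coroot)
  have "- a \<in> \<Phi>"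
    using root_system assms reflection_self[of a] by (metis root_system_def)
  then show ?thesis using pos[of a] pos[of "- a"] root_in_root_cone[OF assms] assms neg by auto
qed

lemma weyl_group_word: "w \<in> weyl_group \<Phi> \<Longrightarrow> \<exists>js\<in>lists J. w = word js"
proof (induction rule: weyl_group.induct)
  case id
  then show ?case by (intro bexI[of _ "[]"]) auto
next
  case (refl w a)
  then obtain js ks where "js \<in> lists J" "w = word js" "ks \<in> lists J" "reflection a = word ks"
    using reflection_word by blast
  then show ?case by (intro bexI[of _ "ks @ js"]) (auto simp: lists_eq_set)
qed

text \<open>Applying the letters from right to left, \<alpha> k leaves the cone at some letter i.
  Just before, it has become \<alpha> i, the only positive root that the reflection in \<alpha> i
  makes negative, so the letters i and k cancel. The bound \<open>length js\<close> is one less than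
  the length of \<open>js @ [k]\<close>.\<close>

lemma deletion:
  assumes "js \<in> lists J" "k \<in> J" "word js (\<alpha> k) \<notin> root_cone"
  shows "\<exists>ks\<in>lists J. length ks \<le> length js \<and> word (js @ [k]) = word ks"
  using assms(1,3)
proof (induction js)
  case Nil
  then show ?case using simple_root_in_root_cone[OF assms(2)] by simp
next
  case (Cons i js)
  have i: "i \<in> J" and js: "js \<in> lists J" using Cons.hyps by auto
  show ?case
  proof (cases "word js (\<alpha> k) \<in> root_cone")
    case False
    then obtain ks where "ks \<in> lists J" "length ks \<le> length js" "word (js @ [k]) = word ks"
      using Cons.IH js by blast
    then show ?thesis using i by (intro bexI[of _ "i # ks"]) auto
  next
    case True
    have W: "word js \<in> weyl_group \<Phi>" using js by (rule word_in_weyl_group)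
    then have "word js (\<alpha> k) \<in> \<Phi>"
      by (rule weyl_group_root[OF root_system _ simple_root[OF assms(2)]])
    then have *: "word js (\<alpha> k) = \<alpha> i"
      using simple_reflection_root_cone[OF i _ True] Cons.prems by auto
    have "reflection (\<alpha> i) (word js (reflection (\<alpha> k) v)) = word js v" for v
      using reflection_conjugate[OF weyl_group_orthogonal[OF W], of "\<alpha> k" "reflection (\<alpha> k) v"]
      by (simp add: *)
    then have "word ((i # js) @ [k]) = word js" by (simp add: fun_eq_iff)
    then show ?thesis using js by (intro bexI[of _ js]) auto
  qed
qed

text \<open>Induction on length. If the word without its last letter k sends \<alpha> k into the
  cone, that letter adds a cone element to the difference; otherwise \<open>deletion\<close> gives a
  shorter word for the same map. The clause on stabilizers shares the induction, as the added
  element is nonzero for regular v.\<close>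

lemma dominant_minus_word:
  assumes "js \<in> lists J" and dom: "\<And>j. j \<in> J \<Longrightarrow> 0 \<le> v \<bullet> \<alpha> j"
  shows "v - word js v \<in> root_cone \<and>
    ((\<forall>j\<in>J. v \<bullet> \<alpha> j \<noteq> 0) \<longrightarrow> word js v = v \<longrightarrow> word js = id)"
  using assms(1)
proof (induction "length js" arbitrary: js rule: less_induct)
  case less
  show ?case
  proof (cases js rule: rev_cases)
    case Nil
    then show ?thesis by (simp add: zero_in_root_cone)
  next
    case (snoc ks k)
    then have k: "k \<in> J" and ks: "ks \<in> lists J" using less.prems by (auto simp: lists_eq_set)
    show ?thesis
    proof (cases "word ks (\<alpha> k) \<in> root_cone")
      case False
      then obtain ls where "ls \<in> lists J" "length ls \<le> length ks" "word js = word ls"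
        using deletion[OF ks k] snoc by blast
      then show ?thesis using less.hyps[of ls] snoc by simp
    next
      case True
      have W: "word ks \<in> weyl_group \<Phi>" using ks by (rule word_in_weyl_group)
      have c: "0 \<le> v \<bullet> coroot (\<alpha> k)" using inner_coroot_nonneg_iff dom k by blast
      have "word js v = word ks v - (v \<bullet> coroot (\<alpha> k)) *\<^sub>R word ks (\<alpha> k)"
        using weyl_group_linear[OF W] by (simp add: snoc reflection_def linear_diff linear_scale)
      then have eq: "v - word js v = (v - word ks v) + (v \<bullet> coroot (\<alpha> k)) *\<^sub>R word ks (\<alpha> k)"
        by simp
      have 1: "v - word ks v \<in> root_cone" using less.hyps[of ks] ks snoc by simp
      have 2: "(v \<bullet> coroot (\<alpha> k)) *\<^sub>R word ks (\<alpha> k) \<in> root_cone"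
        using True c by (rule root_cone_scale)
      \<comment> \<open>Two cone elements with sum 0 both have height 0 and so vanish; the second
        one would force v onto the wall of \<alpha> k.\<close>
      have "word js v \<noteq> v" if "\<forall>j\<in>J. v \<bullet> \<alpha> j \<noteq> 0"
      proof
        assume "word js v = v"
        then have "(v - word ks v) \<bullet> weyl_vector \<alpha> J
            + ((v \<bullet> coroot (\<alpha> k)) *\<^sub>R word ks (\<alpha> k)) \<bullet> weyl_vector \<alpha> J = 0"
          using eq by (metis add.commute diff_self inner_add_left inner_zero_left)
        then have "((v \<bullet> coroot (\<alpha> k)) *\<^sub>R word ks (\<alpha> k)) \<bullet> weyl_vector \<alpha> J = 0"
          using weyl_vector_inner_root_cone[OF 1] weyl_vector_inner_root_cone[OF 2] by linarith
        then have "(v \<bullet> coroot (\<alpha> k)) *\<^sub>R word ks (\<alpha> k) = 0" using root_cone_eq_0[OF 2] by blast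
        moreover have "word ks (\<alpha> k) \<noteq> 0"
          using weyl_group_root[OF root_system W simple_root[OF k]] root_nonzero by blast
        ultimately have "v \<bullet> coroot (\<alpha> k) = 0" by simp
        then show False using that k simple_root_nonzero[OF k] by (simp add: inner_coroot)
      qed
      then show ?thesis using root_cone_add[OF 1 2] unfolding eq[symmetric] by blast
    qed
  qed
qed

section \<open>Dominance, stabilizers and orbits under the Weyl group\<close>

lemma dominant_minus_weyl_group:
  assumes "w \<in> weyl_group \<Phi>" "\<And>j. j \<in> J \<Longrightarrow> 0 \<le> v \<bullet> \<alpha> j"
  shows "v - w v \<in> root_cone"
  using dominant_minus_word assms weyl_group_word by metis

lemma weyl_vector_stabilizer:
  assumes "w \<in> weyl_group \<Phi>" "w (weyl_vector \<alpha> J) = weyl_vector \<alpha> J"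
  shows "w = id"
proof -
  obtain js where js: "js \<in> lists J" "w = word js" using weyl_group_word[OF assms(1)] by blast
  then show ?thesis
    using dominant_minus_word[OF js(1) less_imp_le[OF weyl_vector_inner_simple_root]]
      weyl_vector_inner_simple_root assms(2) js(2) by (metis less_irrefl)
qed

lemma weyl_group_weight:
  assumes "w \<in> weyl_group \<Phi>" "v \<in> weight_lattice \<alpha> J"
  shows "w v \<in> weight_lattice \<alpha> J"
proof -
  have *: "\<alpha> j \<in> weight_lattice \<alpha> J" if "j \<in> J" for j
    using that root_system simple_root
    by (auto simp: weight_lattice_iff simple_root_in_span root_system_def)
  have "reflection (\<alpha> j) u \<in> weight_lattice \<alpha> J" if "j \<in> J" "u \<in> weight_lattice \<alpha> J" for j u
    using that *[OF that(1)] unfolding reflection_def weight_lattice_iff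
    by (auto intro!: span_diff span_scale Ints_diff Ints_mult simp: inner_diff_left)
  then have "word js v \<in> weight_lattice \<alpha> J" if "js \<in> lists J" for js
    using that assms(2) by (induction js) auto
  then show ?thesis using weyl_group_word[OF assms(1)] by auto
qed

text \<open>A point of greatest height in the orbit is dominant, since a simple reflection with
  negative pairing would raise it. The greatest height is found as a least negated height.\<close>

lemma weyl_group_dominant:
  shows "\<exists>w\<in>weyl_group \<Phi>. \<forall>j\<in>J. 0 \<le> w v \<bullet> coroot (\<alpha> j)"
proof -
  have "weyl_group \<Phi> \<noteq> {}" using weyl_group.id by blast
  then obtain w where w: "w \<in> weyl_group \<Phi>"
    "\<And>w'. w' \<in> weyl_group \<Phi> \<Longrightarrow> - (w v \<bullet> weyl_vector \<alpha> J) \<le> - (w' v \<bullet> weyl_vector \<alpha> J)"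
    using arg_min_if_finite(1)[of "weyl_group \<Phi>" "\<lambda>w. - (w v \<bullet> weyl_vector \<alpha> J)"]
      arg_min_least[of "weyl_group \<Phi>" _ "\<lambda>w. - (w v \<bullet> weyl_vector \<alpha> J)"]
      finite_weyl_group[OF root_system] by metis
  have "0 \<le> w v \<bullet> coroot (\<alpha> j)" if j: "j \<in> J" for j
  proof -
    have "reflection (\<alpha> j) \<circ> w \<in> weyl_group \<Phi>"
      using w(1) simple_root[OF j] by (intro weyl_group.refl)
    then have "0 \<le> (w v \<bullet> coroot (\<alpha> j)) * (\<alpha> j \<bullet> weyl_vector \<alpha> J)"
      using w(2)[of "reflection (\<alpha> j) \<circ> w"] by (simp add: reflection_def inner_diff_left)
    then show ?thesis using weyl_vector_pos[OF j] by (simp add: zero_le_mult_iff)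
  qed
  then show ?thesis using w(1) by blast
qed

end

section \<open>The group ring\<close>

text \<open>Equal exponents merge into one key, so the two sums do not match term by term, and h may
  merge further ones. Additivity of the push-forward reduces the claim to single terms.\<close>

lemma sum_single_pushforward:
  fixes h :: "'a \<Rightarrow> 'b" and X :: "'c set" and g :: "'c \<Rightarrow> 'a"
  assumes "finite X"
  defines "f \<equiv> \<Sum>x\<in>X. Poly_Mapping.single (g x) (1::int)"
  shows "(\<Sum>\<mu>\<in>Poly_Mapping.keys f. Poly_Mapping.single (h \<mu>) (Poly_Mapping.lookup f \<mu>))
    = (\<Sum>x\<in>X. Poly_Mapping.single (h (g x)) 1)"
proof -
  define push :: "('a \<Rightarrow>\<^sub>0 int) \<Rightarrow> ('b \<Rightarrow>\<^sub>0 int)"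
    where "push f
      = (\<Sum>\<mu>\<in>Poly_Mapping.keys f. Poly_Mapping.single (h \<mu>) (Poly_Mapping.lookup f \<mu>))" for f
  \<comment> \<open>Additivity needs a common index set for two summands; extra exponents have
    coefficient 0.\<close>
  have superset: "push f = (\<Sum>\<mu>\<in>A. Poly_Mapping.single (h \<mu>) (Poly_Mapping.lookup f \<mu>))"
    if "finite A" "Poly_Mapping.keys f \<subseteq> A" for f A
    unfolding push_def using that by (intro sum.mono_neutral_left) (auto simp: in_keys_iff)
  have add: "push (f + g) = push f + push g" for f g
    using superset[of "Poly_Mapping.keys f \<union> Poly_Mapping.keys g"] Poly_Mapping.keys_add[of f g]
    by (simp add: lookup_add single_add sum.distrib)
  have "push (\<Sum>x\<in>X. Poly_Mapping.single (g x) 1) = (\<Sum>x\<in>X. Poly_Mapping.single (h (g x)) 1)"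
    using assms(1) by induction (simp_all add: add, simp_all add: push_def)
  then show ?thesis by (simp add: push_def f_def)
qed

lemma weyl_act_sum_exp:
  "finite X \<Longrightarrow> weyl_act w (\<Sum>x\<in>X. exp_basis (g x)) = (\<Sum>x\<in>X. exp_basis (w (g x)))"
  unfolding weyl_act_def by (rule sum_single_pushforward)

lemma restrict_ring_sum_exp:
  "finite X \<Longrightarrow> restrict_ring \<alpha> J (\<Sum>x\<in>X. exp_basis (g x))
    = (\<Sum>x\<in>X. exp_basis (restrict_weight \<alpha> J (g x)))"
  unfolding restrict_ring_def by (rule sum_single_pushforward)

lemma lookup_single_mult:
  fixes f :: "'a::group_add \<Rightarrow>\<^sub>0 'b::semiring_0"
  shows "Poly_Mapping.lookup (Poly_Mapping.single a c * f) k = c * Poly_Mapping.lookup f (- a + k)"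
proof -
  have eq: "k = a + q \<longleftrightarrow> - a + k = q" for q
    by (auto simp: add.assoc[symmetric])
  have "Poly_Mapping.lookup (Poly_Mapping.single a c * f) k
      = (\<Sum>l. (c * (\<Sum>q. Poly_Mapping.lookup f q when k = l + q)) when a = l)"
    by (simp add: lookup_mult lookup_single when_mult)
  also have "\<dots> = c * (\<Sum>q. Poly_Mapping.lookup f q when k = a + q)"
    by simp
  also have "\<dots> = c * Poly_Mapping.lookup f (- a + k)"
    by (simp add: eq)
  finally show ?thesis .
qed

text \<open>Turns antisymmetry into vanishing: the integers have no 2-torsion.\<close>

lemma poly_mapping_eq_neg_imp_zero:
  fixes f :: "'a \<Rightarrow>\<^sub>0 int"
  assumes "f = - f"
  shows "f = 0"
proof (rule poly_mapping_eqI)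
  fix k
  have "Poly_Mapping.lookup f k = - Poly_Mapping.lookup f k"
    by (subst assms) simp
  then show "Poly_Mapping.lookup f k = Poly_Mapping.lookup 0 k" by simp
qed

lemma lattice_ring_single: "\<mu> \<in> weight_lattice \<alpha> J \<Longrightarrow> Poly_Mapping.single \<mu> c \<in> lattice_ring \<alpha> J"
  by (simp add: lattice_ring_def)

lemma lattice_ring_zero: "0 \<in> lattice_ring \<alpha> J"
  by (simp add: lattice_ring_def)

lemma lattice_ring_add:
  "f \<in> lattice_ring \<alpha> J \<Longrightarrow> g \<in> lattice_ring \<alpha> J \<Longrightarrow> f + g \<in> lattice_ring \<alpha> J"
  using Poly_Mapping.keys_add[of f g] by (auto simp: lattice_ring_def)

lemma lattice_ring_uminus: "f \<in> lattice_ring \<alpha> J \<Longrightarrow> - f \<in> lattice_ring \<alpha> J"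
  by (simp add: lattice_ring_def)

lemma lattice_ring_sum:
  "(\<And>x. x \<in> X \<Longrightarrow> f x \<in> lattice_ring \<alpha> J) \<Longrightarrow> sum f X \<in> lattice_ring \<alpha> J"
  by (induction X rule: infinite_finite_induct) (auto intro: lattice_ring_zero lattice_ring_add)

section \<open>Alternants\<close>

lemma alternant_det_sign:
  "alternant \<Phi> \<mu> = (\<Sum>w\<in>weyl_group \<Phi>. Poly_Mapping.single (w \<mu>) (det_sign w))"
  by (simp add: alternant_def det_sign_def)

text \<open>Right multiplication by the reflection permutes the Weyl group and flips every
  sign.\<close>

lemma alternant_reflection:
  assumes "a \<in> \<Phi>" "a \<noteq> 0"
  shows "alternant \<Phi> (reflection a \<mu>) = - alternant \<Phi> \<mu>"
proof -
  have "alternant \<Phi> (reflection a \<mu>)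
      = (\<Sum>w\<in>weyl_group \<Phi>. Poly_Mapping.single ((w \<circ> reflection a) \<mu>)
          (- det_sign (w \<circ> reflection a)))"
    unfolding alternant_det_sign
    by (intro sum.cong)
       (simp_all add: det_sign_comp weyl_group_orthogonal orthogonal_transformation_reflection
         det_sign_reflection assms(2))
  also have "\<dots> = (\<Sum>w\<in>weyl_group \<Phi>. Poly_Mapping.single (w \<mu>) (- det_sign w))"
    using weyl_group_comp_bij_right[OF weyl_group_reflection[OF assms(1)]]
    by (rule sum.reindex_bij_betw)
  also have "\<dots> = - alternant \<Phi> \<mu>"
    by (simp add: alternant_det_sign single_uminus sum_negf)
  finally show ?thesis .
qed

text \<open>The sign is left open because divisibility by another alternant does not depend on
  it.\<close>

lemma alternant_weyl_group:
  assumes "w \<in> weyl_group \<Phi>" "0 \<notin> \<Phi>"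
  shows "alternant \<Phi> (w \<mu>) = alternant \<Phi> \<mu> \<or> alternant \<Phi> (w \<mu>) = - alternant \<Phi> \<mu>"
  using assms(1)
proof induction
  case (refl w a)
  then have "a \<noteq> 0" using assms(2) by auto
  then show ?case using refl by (auto simp: alternant_reflection)
qed simp

text \<open>In the term of each w the invariant factor is replaced by its image under w, so that the
  exponents combine to \<open>w (\<mu> + g x)\<close>; then the sums are exchanged.\<close>

lemma alternant_mult_invariant:
  assumes "finite X" "weyl_invariant \<Phi> (\<Sum>x\<in>X. exp_basis (g x))"
  shows "alternant \<Phi> \<mu> * (\<Sum>x\<in>X. exp_basis (g x)) = (\<Sum>x\<in>X. alternant \<Phi> (\<mu> + g x))"
proof -
  have "alternant \<Phi> \<mu> * (\<Sum>x\<in>X. exp_basis (g x))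
      = (\<Sum>w\<in>weyl_group \<Phi>. Poly_Mapping.single (w \<mu>) (det_sign w) * (\<Sum>x\<in>X. exp_basis (g x)))"
    by (simp add: alternant_det_sign sum_distrib_right)
  also have "\<dots> = (\<Sum>w\<in>weyl_group \<Phi>. \<Sum>x\<in>X. Poly_Mapping.single (w (\<mu> + g x)) (det_sign w))"
  proof (rule sum.cong)
    fix w assume w: "w \<in> weyl_group \<Phi>"
    then have "(\<Sum>x\<in>X. exp_basis (g x)) = (\<Sum>x\<in>X. exp_basis (w (g x)))"
      using assms weyl_act_sum_exp by (metis weyl_invariant_def)
    then show "Poly_Mapping.single (w \<mu>) (det_sign w) * (\<Sum>x\<in>X. exp_basis (g x))
      = (\<Sum>x\<in>X. Poly_Mapping.single (w (\<mu> + g x)) (det_sign w))"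
      by (simp add: sum_distrib_left mult_single linear_add[OF weyl_group_linear[OF w]])
  qed simp
  also have "\<dots> = (\<Sum>x\<in>X. alternant \<Phi> (\<mu> + g x))"
    unfolding alternant_det_sign by (rule sum.swap)
  finally show ?thesis .
qed

section \<open>Cancellation of the alternant of the Weyl vector\<close>

context simple_system
begin

lemma alternant_wall:
  assumes "j \<in> J" "\<mu> \<bullet> coroot (\<alpha> j) = 0"
  shows "alternant \<Phi> \<mu> = 0"
proof -
  have "reflection (\<alpha> j) \<mu> = \<mu>" by (simp add: reflection_def assms(2))
  then have "alternant \<Phi> \<mu> = - alternant \<Phi> \<mu>"
    using alternant_reflection[OF simple_root[OF assms(1)] simple_root_nonzero[OF assms(1)], of \<mu>]
    by simp
  then show ?thesis by (rule poly_mapping_eq_neg_imp_zero)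
qed

lemma alternant_weyl_vector_mult_eq_0:
  assumes "alternant \<Phi> (weyl_vector \<alpha> J) * f = 0"
  shows "f = 0"
proof (rule ccontr)
  assume "f \<noteq> 0"
  let ?\<rho> = "weyl_vector \<alpha> J"
  have "finite (Poly_Mapping.keys f)" "Poly_Mapping.keys f \<noteq> {}" using \<open>f \<noteq> 0\<close> by auto
  \<comment> \<open>An exponent of f with the largest pairing with the Weyl vector; its product with
    the leading term of the alternant cannot be cancelled.\<close>
  then obtain \<kappa> where \<kappa>: "\<kappa> \<in> Poly_Mapping.keys f"
    "\<And>\<mu>. \<mu> \<in> Poly_Mapping.keys f \<Longrightarrow> - (\<kappa> \<bullet> ?\<rho>) \<le> - (\<mu> \<bullet> ?\<rho>)"
    using arg_min_if_finite(1)[of "Poly_Mapping.keys f" "\<lambda>\<mu>. - (\<mu> \<bullet> ?\<rho>)"]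
      arg_min_least[of "Poly_Mapping.keys f" _ "\<lambda>\<mu>. - (\<mu> \<bullet> ?\<rho>)"] by metis
  \<comment> \<open>A contribution of w to the coefficient at \<open>?\<rho> + \<kappa>\<close>
    would need an exponent of f with a pairing larger than that of \<open>\<kappa>\<close>.\<close>
  have "Poly_Mapping.lookup f (- w ?\<rho> + (?\<rho> + \<kappa>)) = 0"
    if w: "w \<in> weyl_group \<Phi>" "w \<noteq> id" for w
  proof -
    have "?\<rho> - w ?\<rho> \<in> root_cone"
      by (rule dominant_minus_weyl_group[OF w(1) less_imp_le[OF weyl_vector_inner_simple_root]])
    moreover have "?\<rho> - w ?\<rho> \<noteq> 0" using weyl_vector_stabilizer w by auto
    ultimately have "0 < (?\<rho> - w ?\<rho>) \<bullet> ?\<rho>"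
      using root_cone_eq_0 weyl_vector_inner_root_cone by (metis less_eq_real_def)
    then have "\<kappa> \<bullet> ?\<rho> < (- w ?\<rho> + (?\<rho> + \<kappa>)) \<bullet> ?\<rho>"
      by (simp add: inner_add_left inner_diff_left)
    then show ?thesis using \<kappa>(2) by (force simp: in_keys_iff)
  qed
  then have "Poly_Mapping.lookup (alternant \<Phi> ?\<rho> * f) (?\<rho> + \<kappa>)
      = (\<Sum>w\<in>weyl_group \<Phi>. if w = id then Poly_Mapping.lookup f \<kappa> else 0)"
    unfolding alternant_det_sign sum_distrib_right lookup_sum lookup_single_mult
    by (intro sum.cong) auto
  also have "\<dots> = Poly_Mapping.lookup f \<kappa>"
    by (simp add: finite_weyl_group[OF root_system] weyl_group.id)
  finally show False using assms \<kappa>(1) by (simp add: in_keys_iff)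
qed

lemma alternant_weyl_vector_cancel:
  assumes "alternant \<Phi> (weyl_vector \<alpha> J) * f = alternant \<Phi> (weyl_vector \<alpha> J) * g"
  shows "f = g"
  using alternant_weyl_vector_mult_eq_0[of "f - g"] assms by (simp add: right_diff_distrib)

section \<open>Existence of Weyl bialternants\<close>

text \<open>By Cauchy-Schwarz a bound on the norm bounds the integer coordinates. The strict order
  of real norms is not well-founded, so the induction below counts the weights of smaller norm
  instead.\<close>

lemma finite_weights_bounded: "finite {v \<in> weight_lattice \<alpha> J. norm v \<le> r}"
proof (rule finite_subset)
  let ?N = "\<lambda>j. \<lceil>r * norm (coroot (\<alpha> j))\<rceil>"
  let ?F = "\<lambda>c :: 'i \<Rightarrow> int. \<Sum>j\<in>J. of_int (c j) *\<^sub>R fund_weight \<alpha> J j"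
  show "finite (?F ` (\<Pi>\<^sub>E j\<in>J. {- ?N j..?N j}))"
    by (intro finite_imageI finite_PiE finite_index) simp
  show "{v \<in> weight_lattice \<alpha> J. norm v \<le> r} \<subseteq> ?F ` (\<Pi>\<^sub>E j\<in>J. {- ?N j..?N j})"
  proof
    fix v assume "v \<in> {v \<in> weight_lattice \<alpha> J. norm v \<le> r}"
    then obtain c :: "'i \<Rightarrow> int" where c: "v = ?F c" and v: "norm v \<le> r"
      by (auto simp: weight_lattice_def)
    have "c j \<in> {- ?N j..?N j}" if j: "j \<in> J" for j
    proof -
      have "\<bar>v \<bullet> coroot (\<alpha> j)\<bar> \<le> norm v * norm (coroot (\<alpha> j))" by (rule Cauchy_Schwarz_ineq2)
      also have "\<dots> \<le> r * norm (coroot (\<alpha> j))" using v by (intro mult_right_mono) auto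
      also have "v \<bullet> coroot (\<alpha> j) = of_int (c j)"
        unfolding c by (rule fund_weight_combination_coeff[OF j])
      finally have "\<bar>real_of_int (c j)\<bar> \<le> of_int (?N j)" by linarith
      then show ?thesis by auto
    qed
    moreover have "?F (restrict c J) = v" unfolding c by (intro sum.cong) auto
    ultimately show "v \<in> ?F ` (\<Pi>\<^sub>E j\<in>J. {- ?N j..?N j})"
      by (intro image_eqI[of _ _ "restrict c J"]) auto
  qed
qed

lemma weyl_invariant_orbit_sum:
  "weyl_invariant \<Phi> (\<Sum>\<mu>\<in>(\<lambda>w. w v) ` weyl_group \<Phi>. exp_basis \<mu>)"
  unfolding weyl_invariant_def
proof
  fix w assume w: "w \<in> weyl_group \<Phi>"
  let ?O = "(\<lambda>w. w v) ` weyl_group \<Phi>"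
  have fin: "finite ?O" by (simp add: finite_weyl_group root_system)
  have "w ` ?O = (\<lambda>w. w v) ` (\<lambda>u. w \<circ> u) ` weyl_group \<Phi>" by (simp add: image_image)
  also have "\<dots> = ?O" using weyl_group_comp_bij_left[OF w] by (simp add: bij_betw_def)
  finally have bij: "bij_betw w ?O ?O"
    using weyl_group_bij[OF w] by (auto simp: bij_betw_def intro: inj_on_subset)
  show "weyl_act w (\<Sum>\<mu>\<in>?O. exp_basis \<mu>) = (\<Sum>\<mu>\<in>?O. exp_basis \<mu>)"
    using weyl_act_sum_exp[OF fin, of w "\<lambda>\<mu>. \<mu>"] sum.reindex_bij_betw[OF bij, of exp_basis]
    by simp
qed

text \<open>The product of \<open>alternant \<Phi> \<rho>\<close> with the orbit sum of \<open>v\<close> is \<open>alternant \<Phi> (v + \<rho>)\<close> plus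
  alternants \<open>alternant \<Phi> (\<mu> + \<rho>)\<close> with \<open>norm (\<mu> + \<rho>) < norm (v + \<rho>)\<close>. As only finitely many
  weights have bounded norm, induction applies.\<close>

lemma alternant_divisible:
  assumes "v \<in> dominant_weights \<alpha> J"
  shows "\<exists>f\<in>lattice_ring \<alpha> J.
    alternant \<Phi> (weyl_vector \<alpha> J) * f = alternant \<Phi> (v + weyl_vector \<alpha> J)"
  using assms
proof (induction "card {u \<in> weight_lattice \<alpha> J. norm u < norm (v + weyl_vector \<alpha> J)}"
    arbitrary: v rule: less_induct)
  case less
  let ?\<rho> = "weyl_vector \<alpha> J"
  let ?O = "(\<lambda>w. w v) ` weyl_group \<Phi>"
  let ?F = "\<Sum>\<mu>\<in>?O. exp_basis \<mu>"
  have v: "v \<in> weight_lattice \<alpha> J" and dom: "\<And>j. j \<in> J \<Longrightarrow> 0 \<le> v \<bullet> \<alpha> j"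
    using less.prems inner_coroot_nonneg_iff by (auto simp: dominant_weights_iff)
  have fin: "finite ?O" by (simp add: finite_weyl_group root_system)
  have vO: "v \<in> ?O" using weyl_group.id by (intro image_eqI[of _ _ id]) auto
  have OL: "?O \<subseteq> weight_lattice \<alpha> J" using weyl_group_weight v by auto
  have lower: "\<exists>f\<in>lattice_ring \<alpha> J. alternant \<Phi> ?\<rho> * f = alternant \<Phi> (?\<rho> + \<mu>)"
    if \<mu>: "\<mu> \<in> ?O - {v}" for \<mu>
  proof -
    obtain u where u: "u \<in> weyl_group \<Phi>" "\<mu> = u v" using \<mu> by auto
    have "v - \<mu> \<in> root_cone" using dominant_minus_weyl_group[OF u(1) dom] u(2) by simp
    then have "0 < (v - \<mu>) \<bullet> ?\<rho>"
      using \<mu> root_cone_eq_0 weyl_vector_inner_root_cone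
      by (metis DiffE eq_iff_diff_eq_0 less_eq_real_def singletonI)
    moreover have "\<mu> \<bullet> \<mu> = v \<bullet> v" using u by (simp add: weyl_group_inner)
    \<comment> \<open>As \<mu> and v have equal norm, the squared norms differ by
      \<open>2 * ((v - \<mu>) \<bullet> ?\<rho>)\<close>.\<close>
    ultimately have "(?\<rho> + \<mu>) \<bullet> (?\<rho> + \<mu>) < (v + ?\<rho>) \<bullet> (v + ?\<rho>)"
      by (simp add: inner_add_left inner_add_right inner_diff_left
          inner_commute[of ?\<rho> \<mu>] inner_commute[of ?\<rho> v])
    then have norm_lt: "norm (?\<rho> + \<mu>) < norm (v + ?\<rho>)"
      by (simp add: norm_eq_sqrt_inner)
    \<comment> \<open>Passing to a dominant representative keeps the norm and changes the alternant
      at most by a sign.\<close>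
    obtain w where w: "w \<in> weyl_group \<Phi>" "\<forall>j\<in>J. 0 \<le> w (?\<rho> + \<mu>) \<bullet> coroot (\<alpha> j)"
      using weyl_group_dominant by blast
    let ?\<eta> = "w (?\<rho> + \<mu>)"
    have \<eta>: "?\<eta> \<in> weight_lattice \<alpha> J"
      using \<mu> OL by (intro weyl_group_weight[OF w(1)] weight_lattice_add weyl_vector_weight) auto
    have "\<exists>f\<in>lattice_ring \<alpha> J. alternant \<Phi> ?\<rho> * f = alternant \<Phi> ?\<eta>"
    proof (cases "\<exists>j\<in>J. ?\<eta> \<bullet> coroot (\<alpha> j) = 0")
      case True
      then have "alternant \<Phi> ?\<eta> = 0" using alternant_wall by blast
      then show ?thesis by (intro bexI[of _ 0]) (simp_all add: lattice_ring_zero)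
    next
      case False
      \<comment> \<open>Off the walls the pairings of \<open>?\<eta>\<close> are positive integers,
        hence at least 1, which leaves room to subtract the Weyl vector.\<close>
      have "0 \<le> (?\<eta> - ?\<rho>) \<bullet> coroot (\<alpha> j)" if j: "j \<in> J" for j
      proof -
        have "?\<eta> \<bullet> coroot (\<alpha> j) \<in> \<int>" using \<eta> j by (simp add: weight_lattice_iff)
        moreover have "0 < ?\<eta> \<bullet> coroot (\<alpha> j)" using False w(2) j by (simp add: less_le)
        ultimately have "1 \<le> ?\<eta> \<bullet> coroot (\<alpha> j)" by (auto elim!: Ints_cases)
        then show ?thesis by (simp add: inner_diff_left weyl_vector_coroot j)
      qed
      then have "?\<eta> - ?\<rho> \<in> dominant_weights \<alpha> J"
        by (simp add: dominant_weights_iff weight_lattice_diff \<eta> weyl_vector_weight)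
      moreover have norm_\<eta>: "norm ?\<eta> = norm (?\<rho> + \<mu>)"
        using w(1) by (simp add: norm_eq_sqrt_inner weyl_group_inner)
      have "card {u \<in> weight_lattice \<alpha> J. norm u < norm (?\<eta> - ?\<rho> + ?\<rho>)}
          < card {u \<in> weight_lattice \<alpha> J. norm u < norm (v + ?\<rho>)}"
      proof (rule psubset_card_mono)
        show "finite {u \<in> weight_lattice \<alpha> J. norm u < norm (v + ?\<rho>)}"
          by (rule finite_subset[OF _ finite_weights_bounded[of "norm (v + ?\<rho>)"]]) auto
        show "{u \<in> weight_lattice \<alpha> J. norm u < norm (?\<eta> - ?\<rho> + ?\<rho>)}
          \<subset> {u \<in> weight_lattice \<alpha> J. norm u < norm (v + ?\<rho>)}"
        proof (rule psubsetI)
          have less: "norm ?\<eta> < norm (v + ?\<rho>)" unfolding norm_\<eta> by (rule norm_lt)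
          show "{u \<in> weight_lattice \<alpha> J. norm u < norm (?\<eta> - ?\<rho> + ?\<rho>)}
            \<subseteq> {u \<in> weight_lattice \<alpha> J. norm u < norm (v + ?\<rho>)}"
            unfolding diff_add_cancel by (blast intro: less_trans less)
          have "?\<eta> \<in> {u \<in> weight_lattice \<alpha> J. norm u < norm (v + ?\<rho>)}" using \<eta> less by blast
          moreover have "?\<eta> \<notin> {u \<in> weight_lattice \<alpha> J. norm u < norm (?\<eta> - ?\<rho> + ?\<rho>)}"
            unfolding diff_add_cancel by blast
          ultimately show "{u \<in> weight_lattice \<alpha> J. norm u < norm (?\<eta> - ?\<rho> + ?\<rho>)}
            \<noteq> {u \<in> weight_lattice \<alpha> J. norm u < norm (v + ?\<rho>)}" by metis
        qed
      qed
      ultimately show ?thesis using less.hyps[of "?\<eta> - ?\<rho>"] by simp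
    qed
    then obtain f where f: "f \<in> lattice_ring \<alpha> J" "alternant \<Phi> ?\<rho> * f = alternant \<Phi> ?\<eta>" by blast
    have "0 \<notin> \<Phi>" using root_nonzero by blast
    from alternant_weyl_group[OF w(1) this, of "?\<rho> + \<mu>"] show ?thesis
    proof
      assume "alternant \<Phi> ?\<eta> = alternant \<Phi> (?\<rho> + \<mu>)"
      then show ?thesis using f by auto
    next
      assume "alternant \<Phi> ?\<eta> = - alternant \<Phi> (?\<rho> + \<mu>)"
      then show ?thesis using f by (intro bexI[of _ "- f"]) (simp_all add: lattice_ring_uminus)
    qed
  qed
  then obtain F where F: "\<And>\<mu>. \<mu> \<in> ?O - {v} \<Longrightarrow> F \<mu> \<in> lattice_ring \<alpha> J"
    "\<And>\<mu>. \<mu> \<in> ?O - {v} \<Longrightarrow> alternant \<Phi> ?\<rho> * F \<mu> = alternant \<Phi> (?\<rho> + \<mu>)" by metis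
  have "alternant \<Phi> ?\<rho> * ?F = (\<Sum>\<mu>\<in>?O. alternant \<Phi> (?\<rho> + \<mu>))"
    using alternant_mult_invariant[OF fin, of \<Phi> "\<lambda>\<mu>. \<mu>"] weyl_invariant_orbit_sum[of v] by simp
  also have "\<dots> = alternant \<Phi> (?\<rho> + v) + (\<Sum>\<mu>\<in>?O - {v}. alternant \<Phi> (?\<rho> + \<mu>))"
    by (rule sum.remove[OF fin vO])
  also have "(\<Sum>\<mu>\<in>?O - {v}. alternant \<Phi> (?\<rho> + \<mu>)) = alternant \<Phi> ?\<rho> * (\<Sum>\<mu>\<in>?O - {v}. F \<mu>)"
    by (simp add: sum_distrib_left F(2))
  finally have "alternant \<Phi> ?\<rho> * (?F + - (\<Sum>\<mu>\<in>?O - {v}. F \<mu>)) = alternant \<Phi> (v + ?\<rho>)"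
    by (simp add: algebra_simps)
  moreover have "?F + - (\<Sum>\<mu>\<in>?O - {v}. F \<mu>) \<in> lattice_ring \<alpha> J"
    using F(1) OL
    by (intro lattice_ring_add lattice_ring_uminus lattice_ring_sum lattice_ring_single) auto
  ultimately show ?case by blast
qed

text \<open>Discharges the definite description: existence by \<open>alternant_divisible\<close>,
  uniqueness by cancellation.\<close>

lemma alternant_mult_bialternant:
  assumes "v \<in> dominant_weights \<alpha> J"
  shows "alternant \<Phi> (weyl_vector \<alpha> J) * bialternant \<Phi> \<alpha> J v
    = alternant \<Phi> (v + weyl_vector \<alpha> J)"
proof -
  have "\<exists>!f. f \<in> lattice_ring \<alpha> J \<and>
      alternant \<Phi> (weyl_vector \<alpha> J) * f = alternant \<Phi> (v + weyl_vector \<alpha> J)"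
    using alternant_divisible[OF assms] alternant_weyl_vector_cancel by metis
  from theI'[OF this] show ?thesis by (simp add: bialternant_def)
qed

text \<open>Separates algebra from combinatorics: what remains to be shown for a poset is dominance
  on S, invariance, and the vanishing of the alternant sum over \<open>X - S\<close>.\<close>

lemma bialternant_mult_invariant:
  assumes "finite X" "weyl_invariant \<Phi> (\<Sum>x\<in>X. exp_basis (g x))"
    and "v \<in> dominant_weights \<alpha> J" "S \<subseteq> X"
    and "\<And>s. s \<in> S \<Longrightarrow> v + g s \<in> dominant_weights \<alpha> J"
    and "(\<Sum>x\<in>X - S. alternant \<Phi> (v + g x + weyl_vector \<alpha> J)) = 0"
  shows "bialternant \<Phi> \<alpha> J v * (\<Sum>x\<in>X. exp_basis (g x))
    = (\<Sum>s\<in>S. bialternant \<Phi> \<alpha> J (v + g s))"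
proof (rule alternant_weyl_vector_cancel)
  let ?\<rho> = "weyl_vector \<alpha> J"
  have "alternant \<Phi> ?\<rho> * (bialternant \<Phi> \<alpha> J v * (\<Sum>x\<in>X. exp_basis (g x)))
      = alternant \<Phi> (v + ?\<rho>) * (\<Sum>x\<in>X. exp_basis (g x))"
    by (simp add: mult.assoc[symmetric] alternant_mult_bialternant assms(3))
  also have "\<dots> = (\<Sum>x\<in>X. alternant \<Phi> (v + g x + ?\<rho>))"
    by (simp add: alternant_mult_invariant assms(1,2) add.assoc add.left_commute add.commute)
  also have "\<dots> = (\<Sum>x\<in>S. alternant \<Phi> (v + g x + ?\<rho>))"
    using sum.subset_diff[OF assms(4,1), of "\<lambda>x. alternant \<Phi> (v + g x + ?\<rho>)"] assms(6) by simp
  also have "\<dots> = alternant \<Phi> ?\<rho> * (\<Sum>s\<in>S. bialternant \<Phi> \<alpha> J (v + g s))"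
    by (simp add: sum_distrib_left alternant_mult_bialternant assms(5))
  finally show "alternant \<Phi> ?\<rho> * (bialternant \<Phi> \<alpha> J v * (\<Sum>x\<in>X. exp_basis (g x)))
      = alternant \<Phi> ?\<rho> * (\<Sum>s\<in>S. bialternant \<Phi> \<alpha> J (v + g s))" .
qed

lemma weyl_invariantI:
  assumes "finite X"
    and "\<And>j. j \<in> J \<Longrightarrow> (\<Sum>x\<in>X. exp_basis (reflection (\<alpha> j) (g x))) = (\<Sum>x\<in>X. exp_basis (g x))"
  shows "weyl_invariant \<Phi> (\<Sum>x\<in>X. exp_basis (g x))"
  unfolding weyl_invariant_def
proof
  let ?F = "\<Sum>x\<in>X. exp_basis (g x)"
  have comp: "weyl_act (u \<circ> w) ?F = weyl_act u (\<Sum>x\<in>X. exp_basis (w (g x)))" for u w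
    by (simp add: weyl_act_sum_exp assms(1))
  \<comment> \<open>Letters are split off at the right end because the last letter acts first,
    directly on the sum to which the assumption applies.\<close>
  have "weyl_act (word js) ?F = ?F" if "js \<in> lists J" for js
    using that
  proof (induction js rule: rev_induct)
    case Nil
    then show ?case by (simp add: weyl_act_sum_exp assms(1))
  next
    case (snoc j js)
    then have "weyl_act (word js \<circ> reflection (\<alpha> j)) ?F = weyl_act (word js) ?F"
      unfolding comp by (subst assms(2)) (auto simp: lists_eq_set)
    moreover have "word (js @ [j]) = word js \<circ> reflection (\<alpha> j)" by simp
    moreover have "js \<in> lists J" using snoc.prems by (simp add: lists_eq_set)
    ultimately show ?case using snoc.IH by (simp only:)
  qed
  then show "weyl_act w ?F = ?F" if "w \<in> weyl_group \<Phi>" for w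
    using weyl_group_word[OF that] by auto
qed

end

section \<open>Sums over partitions and ranks\<close>

lemma sum_partition_on:
  assumes "finite X" "partition_on X \<P>"
  shows "(\<Sum>x\<in>X. f x) = (\<Sum>P\<in>\<P>. \<Sum>x\<in>P. f x)"
proof -
  have X: "X = \<Union>\<P>" using assms(2) by (simp add: partition_on_def)
  then have "\<forall>P\<in>\<P>. finite P" using assms(1) by (metis Sup_upper finite_subset)
  moreover have "\<forall>P\<in>\<P>. \<forall>Q\<in>\<P>. P \<noteq> Q \<longrightarrow> P \<inter> Q = {}"
    using assms(2) by (auto simp: partition_on_def disjoint_def)
  ultimately show ?thesis unfolding X by (subst sum.Union_disjoint) auto
qed

lemma partition_on_classes:
  assumes "\<And>x. x \<in> X \<Longrightarrow> x \<in> k x" "\<And>x. x \<in> X \<Longrightarrow> k x \<subseteq> X"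
    and "\<And>x y. x \<in> X \<Longrightarrow> y \<in> k x \<Longrightarrow> k y = k x"
  shows "partition_on X (k ` X)"
  unfolding partition_on_def disjoint_def
proof (intro conjI ballI impI)
  show "\<Union>(k ` X) = X" using assms(1,2) by blast
  show "{} \<notin> k ` X" using assms(1) by blast
  show "p \<inter> q = {}" if "p \<in> k ` X" "q \<in> k ` X" "p \<noteq> q" for p q
    using that assms(3) by blast
qed

text \<open>Both sides are sums over ranks weighted by the sizes of the rank levels.\<close>

lemma sum_rank_symmetric:
  fixes G :: "nat \<Rightarrow> 'b::semiring_1"
  assumes "finite K" "\<rho> ` K \<subseteq> {0..l}"
    and "\<And>i. i \<in> {0..l} \<Longrightarrow> card {x\<in>K. \<rho> x = i} = card {x\<in>K. \<rho> x = l - i}"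
  shows "(\<Sum>x\<in>K. G (l - \<rho> x)) = (\<Sum>x\<in>K. G (\<rho> x))"
proof -
  have "(\<Sum>x\<in>K. G (l - \<rho> x)) = (\<Sum>i\<in>{0..l}. \<Sum>x | x \<in> K \<and> \<rho> x = i. G (l - \<rho> x))"
    using assms(1,2) by (intro sum.group[symmetric]) auto
  also have "\<dots> = (\<Sum>i\<in>{0..l}. of_nat (card {x\<in>K. \<rho> x = i}) * G (l - i))"
    by (intro sum.cong) simp_all
  also have "\<dots> = (\<Sum>i\<in>{0..l}. of_nat (card {x\<in>K. \<rho> x = l - i}) * G (l - i))"
    by (rule sum.cong[OF HOL.refl], subst assms(3)) (assumption, rule HOL.refl)
  also have "\<dots> = (\<Sum>i\<in>{0..l}. of_nat (card {x\<in>K. \<rho> x = i}) * G i)"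
    by (rule sum.reindex_bij_witness[of _ "\<lambda>i. l - i" "\<lambda>i. l - i"]) auto
  also have "\<dots> = (\<Sum>i\<in>{0..l}. \<Sum>x | x \<in> K \<and> \<rho> x = i. G (\<rho> x))"
    by (intro sum.cong) simp_all
  also have "\<dots> = (\<Sum>x\<in>K. G (\<rho> x))"
    using assms(1,2) by (intro sum.group) auto
  finally show ?thesis .
qed

section \<open>Components of an edge-colored poset\<close>

lemma connected_by_refl: "(x, x) \<in> connected_by E"
  by (simp add: connected_by_def)

lemma connected_by_sym: "(x, y) \<in> connected_by E \<Longrightarrow> (y, x) \<in> connected_by E"
  unfolding connected_by_def by (meson symD sym_Un_converse sym_rtrancl)

lemma connected_by_trans:
  "(x, y) \<in> connected_by E \<Longrightarrow> (y, z) \<in> connected_by E \<Longrightarrow> (x, z) \<in> connected_by E"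
  unfolding connected_by_def by (rule rtrancl_trans)

lemma color_comp_self: "x \<in> color_comp R i x"
  by (simp add: color_comp_def connected_by_refl)

lemma color_comp_eq: "y \<in> color_comp R i x \<Longrightarrow> color_comp R i y = color_comp R i x"
  unfolding color_comp_def
  by (blast intro: connected_by_trans connected_by_sym)

lemma color_comp_edge:
  "(s, t) \<in> edges R i \<Longrightarrow> s \<in> color_comp R i x \<longleftrightarrow> t \<in> color_comp R i x"
proof -
  assume "(s, t) \<in> edges R i"
  then have "(s, t) \<in> connected_by (edges R i)" by (auto simp: connected_by_def)
  then show ?thesis unfolding color_comp_def
    by (blast intro: connected_by_trans connected_by_sym)
qed

text \<open>Paths in a component run along edges in either direction, hence two step cases.\<close>

lemma color_comp_induct [consumes 1, case_names self up down]:
  assumes "y \<in> color_comp R i x" "P x"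
    and "\<And>s t. (s, t) \<in> edges R i \<Longrightarrow> s \<in> color_comp R i x \<Longrightarrow> P s \<Longrightarrow> P t"
    and "\<And>s t. (s, t) \<in> edges R i \<Longrightarrow> t \<in> color_comp R i x \<Longrightarrow> P t \<Longrightarrow> P s"
  shows "P y"
proof -
  have "(x, y) \<in> (edges R i \<union> (edges R i)\<inverse>)\<^sup>*"
    using assms(1) by (simp add: color_comp_def connected_by_def)
  then have "P y \<and> y \<in> color_comp R i x"
  proof induction
    case base
    then show ?case using assms(2) color_comp_self by auto
  next
    case (step y z)
    then show ?case using assms(3,4) color_comp_edge[of _ _ R i x] by auto
  qed
  then show ?thesis by simp
qed

lemma edge_elts: "(s, t) \<in> edges R i \<Longrightarrow> s \<in> elts R \<and> t \<in> elts R \<and> s \<noteq> t \<and> (s, t) \<in> leq R"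
  by (auto simp: edges_def covers_def)

lemma color_comp_elts: "x \<in> elts R \<Longrightarrow> color_comp R i x \<subseteq> elts R"
  by (rule subsetI, erule color_comp_induct) (auto dest: edge_elts)

locale ranked_poset =
  fixes I :: "'i set" and R :: "('p, 'i) colored_poset"
  assumes ranked: "ranked_colored_poset I R"
begin

lemma finite_elts: "finite (elts R)"
  using ranked by (simp add: ranked_colored_poset_def)

lemma finite_color_comp: "x \<in> elts R \<Longrightarrow> finite (color_comp R i x)"
  using finite_subset[OF color_comp_elts finite_elts] .

lemma edges_rtrancl_leq: "(s, t) \<in> (edges R i)\<^sup>* \<Longrightarrow> s \<in> elts R \<Longrightarrow> (s, t) \<in> leq R"
proof (induction rule: rtrancl_induct)
  case base
  then show ?case using ranked
    by (auto simp: ranked_colored_poset_def partial_order_on_def preorder_on_def refl_on_def)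
next
  case (step t u)
  moreover have "trans (leq R)" using ranked
    by (auto simp: ranked_colored_poset_def partial_order_on_def preorder_on_def)
  ultimately show ?case by (meson edge_elts transD)
qed

text \<open>Paths of color i edges imply \<open>leq\<close>, so an edge stays a cover in the weaker
  order; conversely, the first edge of a path that realizes a cover is already all of it.\<close>

lemma covers_color_comp:
  assumes "x \<in> elts R"
  shows "covers (color_comp R i x) (comp_order R i x) = {(s, t) \<in> edges R i. s \<in> color_comp R i x}"
    (is "_ = ?E")
proof (intro set_eqI iffI; clarify)
  fix s t assume st: "(s, t) \<in> edges R i" "s \<in> color_comp R i x"
  then have t: "t \<in> color_comp R i x" using color_comp_edge by metis
  have "u = s \<or> u = t"
    if u: "u \<in> color_comp R i x" "(s, u) \<in> comp_order R i x" "(u, t) \<in> comp_order R i x" for u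
  proof -
    have "(s, u) \<in> leq R" "(u, t) \<in> leq R"
      using u st color_comp_elts[OF assms, of i]
      by (auto simp: comp_order_def intro!: edges_rtrancl_leq)
    then show ?thesis using st(1) u(1) color_comp_elts[OF assms]
      by (auto simp: edges_def covers_def)
  qed
  then show "(s, t) \<in> covers (color_comp R i x) (comp_order R i x)"
    using st t edge_elts[OF st(1)] by (auto simp: covers_def comp_order_def)
next
  fix s t assume st: "(s, t) \<in> covers (color_comp R i x) (comp_order R i x)"
  then have "(s, t) \<in> (edges R i)\<^sup>*" "s \<noteq> t" and s: "s \<in> color_comp R i x"
    by (auto simp: covers_def comp_order_def)
  then obtain u where u: "(s, u) \<in> edges R i" "(u, t) \<in> (edges R i)\<^sup>*"
    by (meson converse_rtranclE)
  then have uK: "u \<in> color_comp R i x" using s color_comp_edge by metis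
  then have "(s, u) \<in> comp_order R i x" "(u, t) \<in> comp_order R i x"
    using u s st by (auto simp: comp_order_def covers_def)
  then have "u = s \<or> u = t" using st uK by (auto simp: covers_def)
  then show "(s, t) \<in> edges R i \<and> s \<in> color_comp R i x" using u(1) edge_elts s by metis
qed

lemma rank_function_color_comp_iff:
  assumes "x \<in> elts R"
  shows "rank_function (color_comp R i x) (comp_order R i x) \<rho> l \<longleftrightarrow>
    \<rho> ` color_comp R i x = {0..l} \<and>
    (\<forall>s t. (s, t) \<in> edges R i \<longrightarrow> s \<in> color_comp R i x \<longrightarrow> \<rho> s + 1 = \<rho> t)"
  unfolding rank_function_def covers_color_comp[OF assms] by blast

text \<open>The rank of the whole poset, shifted so that its minimum on the component is 0.\<close>

lemma rank_function_color_comp_exists: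
  assumes "x \<in> elts R"
  shows "\<exists>\<rho> l. rank_function (color_comp R i x) (comp_order R i x) \<rho> l"
proof -
  let ?K = "color_comp R i x"
  obtain \<rho>0 l0 where "rank_function (elts R) (leq R) \<rho>0 l0"
    using ranked by (auto simp: ranked_colored_poset_def)
  then have \<rho>0: "\<rho>0 s + 1 = \<rho>0 t" if "(s, t) \<in> edges R i" for s t
    using that by (auto simp: rank_function_def edges_def)
  have fin: "finite (\<rho>0 ` ?K)" using finite_color_comp[OF assms] by blast
  have ne: "\<rho>0 ` ?K \<noteq> {}" using color_comp_self[of x R i] by blast
  define m where "m = Min (\<rho>0 ` ?K)"
  define M where "M = Max (\<rho>0 ` ?K)"
  obtain y where y: "y \<in> ?K" "\<rho>0 y = m"
    using Min_in[OF fin ne] unfolding m_def by auto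
  have m_le: "m \<le> \<rho>0 z" "\<rho>0 z \<le> M" if "z \<in> ?K" for z
    using that fin by (auto simp: m_def M_def)
  \<comment> \<open>Ranks change by 1 along edges, so a path from y, where the minimum is attained,
    omits no value.\<close>
  have interval: "\<forall>n. m \<le> n \<longrightarrow> n \<le> \<rho>0 z \<longrightarrow> n \<in> \<rho>0 ` ?K" if "z \<in> ?K" for z
  proof -
    have "z \<in> color_comp R i y" using that color_comp_eq[OF y(1)] by simp
    then have "z \<in> ?K \<and> (\<forall>n. m \<le> n \<longrightarrow> n \<le> \<rho>0 z \<longrightarrow> n \<in> \<rho>0 ` ?K)"
    proof (induction rule: color_comp_induct)
      case self
      then show ?case using y by auto
    next
      case (up s t)
      then have "t \<in> ?K" "\<rho>0 t = \<rho>0 s + 1" using color_comp_edge \<rho>0 by (metis, metis)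
      then show ?case using up by (metis Suc_eq_plus1 imageI le_Suc_eq)
    next
      case (down s t)
      then have "s \<in> ?K" "\<rho>0 t = \<rho>0 s + 1" using color_comp_edge \<rho>0 by (metis, metis)
      then show ?case using down by auto
    qed
    then show ?thesis by blast
  qed
  have "(\<lambda>z. \<rho>0 z - m) ` ?K = {0..M - m}"
  proof
    show "(\<lambda>z. \<rho>0 z - m) ` ?K \<subseteq> {0..M - m}" using m_le(2) by (auto intro!: diff_le_mono)
    show "{0..M - m} \<subseteq> (\<lambda>z. \<rho>0 z - m) ` ?K"
    proof
      fix n assume "n \<in> {0..M - m}"
      moreover obtain z where z: "z \<in> ?K" "\<rho>0 z = M"
        using Max_in[OF fin ne] unfolding M_def by auto
      moreover have "m \<le> M" using m_le z by force
      ultimately have "n + m \<in> \<rho>0 ` ?K" using interval[OF z(1)] by auto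
      then show "n \<in> (\<lambda>z. \<rho>0 z - m) ` ?K" by force
    qed
  qed
  moreover have "\<rho>0 s - m + 1 = \<rho>0 t - m" if "(s, t) \<in> edges R i" "s \<in> ?K" for s t
    using \<rho>0[OF that(1)] m_le(1)[OF that(2)] by simp
  ultimately have "rank_function ?K (comp_order R i x) (\<lambda>z. \<rho>0 z - m) (M - m)"
    using rank_function_color_comp_iff[OF assms] by blast
  then show ?thesis by blast
qed

lemma rank_function_color_comp_unique:
  assumes x: "x \<in> elts R"
    and "rank_function (color_comp R i x) (comp_order R i x) \<rho> l"
    and "rank_function (color_comp R i x) (comp_order R i x) \<rho>' l'"
  shows "l = l'" and "y \<in> color_comp R i x \<Longrightarrow> \<rho> y = \<rho>' y"
proof -
  let ?K = "color_comp R i x"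
  have r: "\<rho> ` ?K = {0..l}" "\<And>s t. (s, t) \<in> edges R i \<Longrightarrow> s \<in> ?K \<Longrightarrow> \<rho> s + 1 = \<rho> t"
    and r': "\<rho>' ` ?K = {0..l'}" "\<And>s t. (s, t) \<in> edges R i \<Longrightarrow> s \<in> ?K \<Longrightarrow> \<rho>' s + 1 = \<rho>' t"
    using assms(2,3) unfolding rank_function_color_comp_iff[OF x] by blast+
  have shift: "int (\<rho> y) - int (\<rho>' y) = int (\<rho> x) - int (\<rho>' x)" if "y \<in> ?K" for y
    using that
  proof (induction rule: color_comp_induct)
    case (up s t)
    then show ?case using r(2)[of s t] r'(2)[of s t] by simp
  next
    case (down s t)
    then have "s \<in> ?K" using color_comp_edge by metis
    then show ?case using down r(2)[of s t] r'(2)[of s t] by simp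
  qed simp
  have "0 \<in> \<rho> ` ?K" "0 \<in> \<rho>' ` ?K" using r(1) r'(1) by auto
  \<comment> \<open>The difference of the two functions is constant; it is nonpositive at u and
    nonnegative at v, so it is 0.\<close>
  then obtain u v where "u \<in> ?K" "\<rho> u = 0" "v \<in> ?K" "\<rho>' v = 0" by (metis imageE)
  then have "int (\<rho> x) = int (\<rho>' x)" using shift[of u] shift[of v] by simp
  then have eq: "\<rho> y = \<rho>' y" if "y \<in> ?K" for y using shift[OF that] by simp
  then show "y \<in> ?K \<Longrightarrow> \<rho> y = \<rho>' y" .
  have "{0..l} = {0..l'}" using r(1) r'(1) eq by (metis image_cong)
  then show "l = l'" by simp
qed

lemma comp_order_eq: "y \<in> color_comp R i x \<Longrightarrow> comp_order R i y = comp_order R i x"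
  by (simp add: comp_order_def color_comp_eq)

text \<open>\<open>comp_rank\<close> is a description based at each vertex separately. All vertices
  of a component define the same ordered set, so by uniqueness these values form one rank
  function.\<close>

lemma rank_function_comp_rank:
  assumes x: "x \<in> elts R"
  shows "rank_function (color_comp R i x) (comp_order R i x) (comp_rank R i) (comp_length R i x)"
proof -
  obtain \<rho> l where r: "rank_function (color_comp R i x) (comp_order R i x) \<rho> l"
    using rank_function_color_comp_exists[OF x] by blast
  have l: "comp_length R i x = l" unfolding comp_length_def
    using r rank_function_color_comp_unique(1)[OF x _ r] by (intro the_equality) blast+
  have \<rho>: "comp_rank R i y = \<rho> y" if y: "y \<in> color_comp R i x" for y
    unfolding comp_rank_def comp_order_eq[OF y] color_comp_eq[OF y]
    using r rank_function_color_comp_unique(2)[OF x _ r y] by (intro the_equality) blast+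
  show ?thesis using r
    unfolding rank_function_color_comp_iff[OF x] l
    using \<rho> color_comp_edge by (metis (no_types, lifting) image_cong)
qed

lemma comp_rank_image:
  "x \<in> elts R \<Longrightarrow> comp_rank R i ` color_comp R i x = {0..comp_length R i x}"
  using rank_function_comp_rank by (simp add: rank_function_def)

lemma comp_rank_le: "x \<in> elts R \<Longrightarrow> y \<in> color_comp R i x \<Longrightarrow> comp_rank R i y \<le> comp_length R i x"
  using comp_rank_image by fastforce

lemma comp_rank_edge: "(s, t) \<in> edges R i \<Longrightarrow> comp_rank R i t = comp_rank R i s + 1"
  using rank_function_comp_rank[of s i] rank_function_color_comp_iff[of s i] edge_elts
    color_comp_self
  by metis

lemma comp_rank_strict_mono:
  assumes "(s, t) \<in> (edges R i)\<^sup>*"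
  shows "s = t \<or> comp_rank R i s < comp_rank R i t"
  using assms by (induction rule: rtrancl_induct) (auto dest!: comp_rank_edge)

lemma rank_symmetric_card:
  assumes "x \<in> elts R" "rank_symmetric (color_comp R i x) (comp_order R i x)"
    and "n \<in> {0..comp_length R i x}"
  shows "card {y \<in> color_comp R i x. comp_rank R i y = n}
    = card {y \<in> color_comp R i x. comp_rank R i y = comp_length R i x - n}"
proof -
  obtain \<rho> l where r: "rank_function (color_comp R i x) (comp_order R i x) \<rho> l"
    "\<forall>i'\<in>{0..l}. card {y\<in>color_comp R i x. \<rho> y = i'} = card {y\<in>color_comp R i x. \<rho> y = l - i'}"
    using assms(2) by (auto simp: rank_symmetric_def)
  have l: "comp_length R i x = l"
    and \<rho>: "\<And>y. y \<in> color_comp R i x \<Longrightarrow> comp_rank R i y = \<rho> y"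
    using rank_function_color_comp_unique[OF assms(1) rank_function_comp_rank[OF assms(1)] r(1)]
    by blast+
  have "{y \<in> color_comp R i x. comp_rank R i y = k} = {y \<in> color_comp R i x. \<rho> y = k}" for k
    using \<rho> by auto
  moreover have "card {y\<in>color_comp R i x. \<rho> y = n} = card {y\<in>color_comp R i x. \<rho> y = l - n}"
    using r(2) assms(3) unfolding l by (rule bspec)
  ultimately show ?thesis unfolding l by (simp only:)
qed

end

section \<open>Weights along components\<close>

context simple_system
begin

lemma wt_coroot: "j \<in> J \<Longrightarrow> wt \<alpha> J R x \<bullet> coroot (\<alpha> j) = of_int (comp_mult R j x)"
  by (simp add: wt_def fund_weight_combination_coeff)

lemma wt_weight: "wt \<alpha> J R x \<in> weight_lattice \<alpha> J"
  using fund_weight_combination_in_span[of "\<lambda>j. of_int (comp_mult R j x)"]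
  by (simp add: weight_lattice_iff wt_coroot) (simp add: wt_def)

end

text \<open>Comparing the integer expansion over I with a real one over J, independence forces the
  coefficients outside J to be 0, so the signs remain uniform.\<close>

lemma subsystem_simple_system:
  assumes "root_system \<Phi>" "simple_roots \<Phi> \<alpha> I" "J \<subseteq> I"
  shows "simple_system (subsystem \<Phi> \<alpha> J) \<alpha> J"
proof
  interpret big: simple_system \<Phi> \<alpha> I by unfold_locales (use assms in auto)
  show "root_system (subsystem \<Phi> \<alpha> J)"
    using assms(1) unfolding root_system_def subsystem_def
    by (auto simp: reflection_def intro: span_diff span_scale)
  show "simple_roots (subsystem \<Phi> \<alpha> J) \<alpha> J"
    unfolding simple_roots_def
  proof (intro conjI ballI)
    show "inj_on \<alpha> J" using assms by (auto simp: simple_roots_def intro: inj_on_subset)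
    show "\<alpha> ` J \<subseteq> subsystem \<Phi> \<alpha> J"
      using assms by (auto simp: simple_roots_def subsystem_def intro: span_base)
    show "independent (\<alpha> ` J)"
      using assms by (meson image_mono independent_mono simple_roots_def)
    fix b assume b: "b \<in> subsystem \<Phi> \<alpha> J"
    then obtain c :: "'b \<Rightarrow> int" where c: "b = (\<Sum>i\<in>I. of_int (c i) *\<^sub>R \<alpha> i)"
      "(\<forall>i\<in>I. 0 \<le> c i) \<or> (\<forall>i\<in>I. c i \<le> 0)"
      using assms(2) unfolding simple_roots_def subsystem_def by blast
    have inj: "inj_on \<alpha> J" by fact
    have fin: "finite J" using big.finite_index assms(3) finite_subset by blast
    have "b \<in> span (\<alpha> ` J)" using b by (simp add: subsystem_def)
    then obtain u where "b = (\<Sum>v\<in>\<alpha> ` J. u v *\<^sub>R v)"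
      using fin by (auto simp: span_finite)
    then have "b = (\<Sum>j\<in>J. u (\<alpha> j) *\<^sub>R \<alpha> j)" by (simp add: sum.reindex[OF inj])
    also have "\<dots> = (\<Sum>i\<in>I. (if i \<in> J then u (\<alpha> i) else 0) *\<^sub>R \<alpha> i)"
      using assms(3) big.finite_index by (intro sum.mono_neutral_cong_left) auto
    finally have "of_int (c i) = (if i \<in> J then u (\<alpha> i) else 0)" if "i \<in> I" for i
      using big.coeff_unique[of "\<lambda>i. of_int (c i)" "\<lambda>i. if i \<in> J then u (\<alpha> i) else 0" i]
        c(1) that by simp
    then have "(\<Sum>i\<in>I. of_int (c i) *\<^sub>R \<alpha> i) = (\<Sum>i\<in>J. of_int (c i) *\<^sub>R \<alpha> i)"
      using assms(3) big.finite_index by (intro sum.mono_neutral_right) auto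
    then show "\<exists>c :: 'b \<Rightarrow> int. b = (\<Sum>i\<in>J. of_int (c i) *\<^sub>R \<alpha> i) \<and>
        ((\<forall>i\<in>J. 0 \<le> c i) \<or> (\<forall>i\<in>J. c i \<le> 0))"
      using c assms(3) by (intro exI[of _ c]) auto
  qed
qed

text \<open>Here \<open>\<Phi>\<close> stands for the subsystem with simple roots indexed by J,
  while the edges of R are colored by I.\<close>

locale structured_poset = simple_system \<Phi> \<alpha> J + ranked_poset I R
  for \<Phi> :: "(real ^ 'n) set" and \<alpha> :: "'i \<Rightarrow> real ^ 'n" and J :: "'i set"
    and I :: "'i set" and R :: "('p, 'i) colored_poset" +
  assumes structured: "structured \<alpha> J R"
begin

abbreviation "weight \<equiv> wt \<alpha> J R"

lemma weight_coroot:
  "j \<in> J \<Longrightarrow> weight x \<bullet> coroot (\<alpha> j) = 2 * real (comp_rank R j x) - real (comp_length R j x)"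
  by (simp add: wt_coroot comp_mult_def comp_depth_def)

text \<open>An edge adds \<alpha> j to the weight and 1 to the rank. The constant is the weight at
  rank 0, the start of the string.\<close>

lemma weight_color_comp:
  assumes "j \<in> J" "y \<in> color_comp R j x"
  shows "weight y - real (comp_rank R j y) *\<^sub>R \<alpha> j = weight x - real (comp_rank R j x) *\<^sub>R \<alpha> j"
proof -
  have edge: "weight t - real (comp_rank R j t) *\<^sub>R \<alpha> j = weight s - real (comp_rank R j s) *\<^sub>R \<alpha> j"
    if "(s, t) \<in> edges R j" for s t
  proof -
    have "weight s + \<alpha> j = weight t" using structured that assms(1) by (auto simp: structured_def)
    then show ?thesis using comp_rank_edge[OF that]
      by (simp add: algebra_simps flip: \<open>weight s + \<alpha> j = weight t\<close>)
  qed
  show ?thesis using assms(2) by (induction rule: color_comp_induct) (auto dest: edge)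
qed

lemma weight_eq:
  assumes "j \<in> J" "y \<in> color_comp R j x"
  shows "v + weight y
    = (v + weight x - real (comp_rank R j x) *\<^sub>R \<alpha> j) + real (comp_rank R j y) *\<^sub>R \<alpha> j"
  using weight_color_comp[OF assms] by (simp add: algebra_simps)

text \<open>The start of the shifted string pairs to \<open>v \<bullet> coroot (\<alpha> j)\<close>
  minus the length, and each position adds 2. With v = 0 the reflection reverses ranks; with v =
  \<nu> + \<rho> it produces the constant of the kindred hypotheses.\<close>

lemma reflection_weight_string:
  assumes "j \<in> J"
  shows "reflection (\<alpha> j) ((v + weight x - real (comp_rank R j x) *\<^sub>R \<alpha> j) + t *\<^sub>R \<alpha> j)
    = (v + weight x - real (comp_rank R j x) *\<^sub>R \<alpha> j)
      + (real (comp_length R j x) - v \<bullet> coroot (\<alpha> j) - t) *\<^sub>R \<alpha> j"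
proof -
  have "((v + weight x - real (comp_rank R j x) *\<^sub>R \<alpha> j) + t *\<^sub>R \<alpha> j) \<bullet> coroot (\<alpha> j)
      = v \<bullet> coroot (\<alpha> j) - real (comp_length R j x) + 2 * t"
    using inner_coroot_self[OF simple_root_nonzero[OF assms]]
    by (simp add: inner_add_left inner_diff_left weight_coroot[OF assms])
  moreover have "real (comp_length R j x) - v \<bullet> coroot (\<alpha> j) - t
      = t - (v \<bullet> coroot (\<alpha> j) - real (comp_length R j x) + 2 * t)" by simp
  ultimately show ?thesis by (simp only: reflection_def scaleR_left_diff_distrib add_diff_eq)
qed

lemma weyl_invariant_rank_symmetric:
  assumes "\<And>j x. j \<in> J \<Longrightarrow> x \<in> elts R \<Longrightarrow> rank_symmetric (color_comp R j x) (comp_order R j x)"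
  shows "weyl_invariant \<Phi> (\<Sum>x\<in>elts R. exp_basis (weight x))"
proof (rule weyl_invariantI[OF finite_elts])
  fix j assume j: "j \<in> J"
  have part: "partition_on (elts R) (color_comp R j ` elts R)"
    by (intro partition_on_classes color_comp_self color_comp_elts color_comp_eq)
  have "(\<Sum>y\<in>K. exp_basis (reflection (\<alpha> j) (weight y))) = (\<Sum>y\<in>K. exp_basis (weight y))"
    if K: "K \<in> color_comp R j ` elts R" for K
  proof -
    obtain x where x: "x \<in> elts R" "K = color_comp R j x" using K by blast
    let ?l = "comp_length R j x" and ?r = "comp_rank R j"
    \<comment> \<open>The summand 0 is the case v = 0 of
      \<open>reflection_weight_string\<close>.\<close>
    define G where "G n = exp_basis ((0 + weight x - real (?r x) *\<^sub>R \<alpha> j) + real n *\<^sub>R \<alpha> j)" for n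
    have G: "exp_basis (weight y) = G (?r y)"
      "exp_basis (reflection (\<alpha> j) (weight y)) = G (?l - ?r y)" if "y \<in> K" for y
    proof -
      have y: "weight y = (0 + weight x - real (?r x) *\<^sub>R \<alpha> j) + real (?r y) *\<^sub>R \<alpha> j"
        using weight_eq[OF j, of y x 0] that x by simp
      have le: "?r y \<le> ?l" using comp_rank_le that x by blast
      show "exp_basis (weight y) = G (?r y)" unfolding G_def y ..
      show "exp_basis (reflection (\<alpha> j) (weight y)) = G (?l - ?r y)"
        unfolding G_def y reflection_weight_string[OF j] using le by (simp add: of_nat_diff)
    qed
    have "(\<Sum>y\<in>K. G (?l - ?r y)) = (\<Sum>y\<in>K. G (?r y))"
      unfolding x(2)
      by (rule sum_rank_symmetric)
         (use x(1) comp_rank_image finite_color_comp rank_symmetric_card assms[OF j] in \<open>blast+\<close>)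
    then show ?thesis using G by simp
  qed
  then show "(\<Sum>x\<in>elts R. exp_basis (reflection (\<alpha> j) (weight x)))
      = (\<Sum>x\<in>elts R. exp_basis (weight x))"
    unfolding sum_partition_on[OF finite_elts part] by (rule sum.cong[OF HOL.refl])
qed

section \<open>Cancellation on kindred sets\<close>

lemma kindred_self: "x \<in> elts R - S \<Longrightarrow> x \<in> kindred R S \<kappa> x"
  by (simp add: kindred_def color_comp_self)

lemma kindred_eq: "y \<in> kindred R S \<kappa> x \<Longrightarrow> kindred R S \<kappa> y = kindred R S \<kappa> x"
  by (auto simp: kindred_def color_comp_eq)

lemma sum_alternant_symmetric_chain:
  assumes k: "k \<in> J" and x: "x \<in> elts R" and C: "C \<subseteq> color_comp R k x"
    and chain: "C \<in> Chains (comp_order R k x)"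
    and pq: "p \<in> C" "q \<in> C" "\<And>z. z \<in> C \<Longrightarrow> (p, z) \<in> comp_order R k x \<and> (z, q) \<in> comp_order R k x"
    and card: "int (comp_rank R k q) - int (comp_rank R k p) = int (card C) - 1"
    and v: "v \<bullet> coroot (\<alpha> k)
      = real (comp_length R k x) - real (comp_rank R k p + comp_rank R k q)"
  shows "(\<Sum>y\<in>C. alternant \<Phi> (v + weight y)) = 0"
proof -
  let ?r = "comp_rank R k"
  define G where "G n = alternant \<Phi> ((v + weight x - real (?r x) *\<^sub>R \<alpha> k) + real n *\<^sub>R \<alpha> k)" for n
  have fin: "finite C" using C finite_color_comp[OF x] by (rule finite_subset)
  have mono: "s = t \<or> ?r s < ?r t" if "(s, t) \<in> comp_order R k x" for s t
    using that comp_rank_strict_mono by (auto simp: comp_order_def)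
  have inj: "inj_on ?r C"
  proof (rule inj_onI)
    fix s t assume "s \<in> C" "t \<in> C" "?r s = ?r t"
    then show "s = t" using chain mono[of s t] mono[of t s] by (auto simp: Chains_def)
  qed
  \<comment> \<open>Ranks are distinct along a chain and lie between those of its ends, so the count
    \<open>card\<close> leaves no gaps.\<close>
  have "?r ` C = {?r p..?r q}"
  proof (rule card_subset_eq)
    show "?r ` C \<subseteq> {?r p..?r q}"
      using pq(3) mono by (fastforce simp: less_imp_le)
    show "card (?r ` C) = card {?r p..?r q}"
      using card by (simp add: card_image[OF inj])
  qed simp
  then have sum: "(\<Sum>y\<in>C. G (?r y)) = (\<Sum>n\<in>{?r p..?r q}. G n)"
    using sum.reindex[OF inj, of G] by simp
  \<comment> \<open>The assumption on v turns the constant of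
    \<open>reflection_weight_string\<close> into the sum of the ranks of the two ends.\<close>
  have G: "G (?r p + ?r q - n) = - G n" if "n \<in> {?r p..?r q}" for n
  proof -
    have "reflection (\<alpha> k) ((v + weight x - real (?r x) *\<^sub>R \<alpha> k) + real n *\<^sub>R \<alpha> k)
        = (v + weight x - real (?r x) *\<^sub>R \<alpha> k) + real (?r p + ?r q - n) *\<^sub>R \<alpha> k"
      unfolding reflection_weight_string[OF k] v using that by (simp add: of_nat_diff)
    then show ?thesis
      unfolding G_def by (metis alternant_reflection k simple_root simple_root_nonzero)
  qed
  have "(\<Sum>n\<in>{?r p..?r q}. G n) = (\<Sum>n\<in>{?r p..?r q}. G (?r p + ?r q - n))"
    by (rule sum.reindex_bij_witness[of _ "\<lambda>n. ?r p + ?r q - n" "\<lambda>n. ?r p + ?r q - n"]) auto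
  also have "\<dots> = - (\<Sum>n\<in>{?r p..?r q}. G n)" by (simp add: G sum_negf)
  finally have "(\<Sum>n\<in>{?r p..?r q}. G n) = 0" by (rule poly_mapping_eq_neg_imp_zero)
  moreover have "(\<Sum>y\<in>C. alternant \<Phi> (v + weight y)) = (\<Sum>y\<in>C. G (?r y))"
    using C by (intro sum.cong) (auto simp: G_def weight_eq[OF k, of _ x v])
  ultimately show ?thesis using sum by simp
qed

text \<open>Kindred sets partition the complement of S and chains partition each kindred set. The
  assumed pairings are those of \<nu> + \<rho>.\<close>

lemma sum_alternant_kindred:
  assumes "\<kappa> \<in> (elts R - S) \<rightarrow> J"
    and "\<And>j. j \<in> J \<Longrightarrow> v \<bullet> coroot (\<alpha> j) = real (c j + 1)"
    and kindred: "\<And>x. x \<in> elts R - S \<Longrightarrow> c (\<kappa> x) + 1 \<le> comp_length R (\<kappa> x) x \<and>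
      (\<exists>\<C>. symmetric_chain_decomposition (kindred R S \<kappa> x) (kindred_order R S \<kappa> x)
        (comp_rank R (\<kappa> x)) (comp_length R (\<kappa> x) x - (c (\<kappa> x) + 1)) \<C>)"
  shows "(\<Sum>x\<in>elts R - S. alternant \<Phi> (v + weight x)) = 0"
proof -
  have part: "partition_on (elts R - S) (kindred R S \<kappa> ` (elts R - S))"
    by (intro partition_on_classes kindred_self kindred_eq) (auto simp: kindred_def)
  have "(\<Sum>y\<in>kindred R S \<kappa> x. alternant \<Phi> (v + weight y)) = 0" if x: "x \<in> elts R - S" for x
  proof -
    let ?K = "kindred R S \<kappa> x" and ?k = "\<kappa> x"
    let ?l = "comp_length R ?k x"
    have k: "?k \<in> J" using assms(1) x by auto
    have K: "?K \<subseteq> color_comp R ?k x" by (auto simp: kindred_def)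
    obtain \<C> where \<C>: "partition_on ?K \<C>"
      "\<And>C. C \<in> \<C> \<Longrightarrow> C \<in> Chains (kindred_order R S \<kappa> x)"
      "\<And>C. C \<in> \<C> \<Longrightarrow> \<exists>p\<in>C. \<exists>q\<in>C.
        (\<forall>z\<in>C. (p, z) \<in> kindred_order R S \<kappa> x \<and> (z, q) \<in> kindred_order R S \<kappa> x) \<and>
        comp_rank R ?k p + comp_rank R ?k q = ?l - (c ?k + 1) \<and>
        int (comp_rank R ?k q) - int (comp_rank R ?k p) = int (card C) - 1"
      using kindred[OF x] unfolding symmetric_chain_decomposition_def by blast
    have sub: "kindred_order R S \<kappa> x \<subseteq> comp_order R ?k x" by (auto simp: kindred_order_def)
    have "(\<Sum>y\<in>C. alternant \<Phi> (v + weight y)) = 0" if C: "C \<in> \<C>" for C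
    proof -
      obtain p q where pq: "p \<in> C" "q \<in> C"
        "\<forall>z\<in>C. (p, z) \<in> kindred_order R S \<kappa> x \<and> (z, q) \<in> kindred_order R S \<kappa> x"
        "comp_rank R ?k p + comp_rank R ?k q = ?l - (c ?k + 1)"
        "int (comp_rank R ?k q) - int (comp_rank R ?k p) = int (card C) - 1"
        using \<C>(3)[OF C] by blast
      show ?thesis
      proof (rule sum_alternant_symmetric_chain[OF k _ _ _ pq(1,2) _ pq(5)])
        show "x \<in> elts R" using x by simp
        show "C \<subseteq> color_comp R ?k x" using C \<C>(1) K by (auto simp: partition_on_def)
        show "C \<in> Chains (comp_order R ?k x)" using \<C>(2)[OF C] sub by (auto simp: Chains_def)
        show "(p, z) \<in> comp_order R ?k x \<and> (z, q) \<in> comp_order R ?k x" if "z \<in> C" for z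
          using pq(3) sub that by blast
        \<comment> \<open>The rank sum is a difference of naturals; it is not truncated because
          \<open>c ?k + 1\<close> is at most \<open>?l\<close>.\<close>
        show "v \<bullet> coroot (\<alpha> ?k)
            = real ?l - real (comp_rank R ?k p + comp_rank R ?k q)"
          unfolding pq(4) assms(2)[OF k] using kindred[OF x] by (simp add: of_nat_diff)
      qed
    qed
    moreover have "finite ?K" using K finite_color_comp x by (meson DiffD1 finite_subset)
    ultimately show ?thesis
      using sum_partition_on[OF _ \<C>(1), of "\<lambda>y. alternant \<Phi> (v + weight y)"] by simp
  qed
  then have "\<forall>K\<in>kindred R S \<kappa> ` (elts R - S). (\<Sum>y\<in>K. alternant \<Phi> (v + weight y)) = 0"
    by blast
  moreover have "finite (elts R - S)" using finite_elts by simp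
  ultimately show ?thesis by (simp only: sum_partition_on[OF _ part] sum.neutral)
qed

end

text \<open>Restriction keeps the coefficients at the fundamental weights indexed by J, and these do
  not depend on whether the weight is formed over I or over J.\<close>

lemma restrict_ring_WGF:
  assumes "root_system \<Phi>" "simple_roots \<Phi> \<alpha> I" "J \<subseteq> I" "finite (elts R)"
  shows "restrict_ring \<alpha> J (WGF \<alpha> I R) = (\<Sum>x\<in>elts R. exp_basis (wt \<alpha> J R x))"
proof -
  interpret simple_system \<Phi> \<alpha> I by unfold_locales (use assms in auto)
  have "restrict_weight \<alpha> J (wt \<alpha> I R x) = wt \<alpha> J R x" for x
    unfolding restrict_weight_def using assms(3)
    by (subst (2) wt_def) (auto simp: wt_coroot intro!: sum.cong)
  then show ?thesis by (simp add: WGF_def restrict_ring_sum_exp assms(4))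
qed

text \<open>The first conjunct is the parenthetical remark on rank symmetry. R is structured only
  over J, whereas \<open>splitting_poset\<close> asks for a structure over I, so that conclusion
  alone has the premise \<open>structured \<alpha> I R\<close>. The bound on \<open>c k + 1\<close>
  keeps the subtraction in the range of ranks from being truncated.\<close>

theorem theorem8p1:
  fixes \<Phi> :: "(real ^ 'n) set" and \<alpha> :: "'i \<Rightarrow> real ^ 'n" and I J :: "'i set"
    and \<nu> :: "real ^ 'n" and c :: "'i \<Rightarrow> nat" and R :: "('p, 'i) colored_poset"
  assumes "root_system \<Phi>" and "simple_roots \<Phi> \<alpha> I" and "J \<subseteq> I"
    and "\<nu> \<in> dominant_weights \<alpha> J"
    and "\<nu> = (\<Sum>j\<in>J. of_nat (c j) *\<^sub>R fund_weight \<alpha> J j)"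
    and "ranked_colored_poset I R" and "structured \<alpha> J R"
  shows
    "((\<forall>j\<in>J. \<forall>x\<in>elts R. rank_symmetric (color_comp R j x) (comp_order R j x)) \<longrightarrow>
        weyl_invariant (subsystem \<Phi> \<alpha> J) (restrict_ring \<alpha> J (WGF \<alpha> I R))) \<and>
     (weyl_invariant (subsystem \<Phi> \<alpha> J) (restrict_ring \<alpha> J (WGF \<alpha> I R)) \<longrightarrow>
      (\<forall>S \<kappa>. S \<subseteq> {x \<in> elts R. \<forall>j\<in>J. comp_depth R j x \<le> int (c j)} \<longrightarrow>
        \<kappa> \<in> (elts R - S) \<rightarrow> J \<longrightarrow>
        (\<forall>x\<in>elts R - S. \<forall>k. k = \<kappa> x \<longrightarrow>
           c k + 1 \<le> comp_length R k x \<and>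
           rank_function (kindred R S \<kappa> x) (kindred_order R S \<kappa> x)
             (comp_rank R k) (comp_length R k x - (c k + 1)) \<and>
           (\<exists>\<C>. symmetric_chain_decomposition (kindred R S \<kappa> x) (kindred_order R S \<kappa> x)
             (comp_rank R k) (comp_length R k x - (c k + 1)) \<C>)) \<longrightarrow>
        (\<forall>s\<in>S. \<nu> + wt \<alpha> J R s \<in> dominant_weights \<alpha> J) \<and>
        bialternant (subsystem \<Phi> \<alpha> J) \<alpha> J \<nu> * restrict_ring \<alpha> J (WGF \<alpha> I R) =
          (\<Sum>s\<in>S. bialternant (subsystem \<Phi> \<alpha> J) \<alpha> J (\<nu> + wt \<alpha> J R s)) \<and>
        (structured \<alpha> I R \<longrightarrow> splitting_poset \<Phi> \<alpha> I J \<nu> R S)))"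
proof -
  interpret simple_system "subsystem \<Phi> \<alpha> J" \<alpha> J
    by (rule subsystem_simple_system[OF assms(1-3)])
  interpret structured_poset "subsystem \<Phi> \<alpha> J" \<alpha> J I R
    by unfold_locales (use assms in auto)
  let ?\<Phi>J = "subsystem \<Phi> \<alpha> J" and ?\<rho> = "weyl_vector \<alpha> J"
  have WGF: "restrict_ring \<alpha> J (WGF \<alpha> I R) = (\<Sum>x\<in>elts R. exp_basis (weight x))"
    by (rule restrict_ring_WGF[OF assms(1-3) finite_elts])
  have \<nu>: "\<nu> \<bullet> coroot (\<alpha> j) = real (c j)" if "j \<in> J" for j
    unfolding assms(5) by (rule fund_weight_combination_coeff[OF that])
  have splitting: "(\<forall>s\<in>S. \<nu> + weight s \<in> dominant_weights \<alpha> J) \<and>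
      bialternant ?\<Phi>J \<alpha> J \<nu> * restrict_ring \<alpha> J (WGF \<alpha> I R) =
        (\<Sum>s\<in>S. bialternant ?\<Phi>J \<alpha> J (\<nu> + weight s)) \<and>
      (structured \<alpha> I R \<longrightarrow> splitting_poset \<Phi> \<alpha> I J \<nu> R S)"
    if inv: "weyl_invariant ?\<Phi>J (restrict_ring \<alpha> J (WGF \<alpha> I R))"
      and S: "S \<subseteq> {x \<in> elts R. \<forall>j\<in>J. comp_depth R j x \<le> int (c j)}"
      and \<kappa>: "\<kappa> \<in> (elts R - S) \<rightarrow> J"
      and kindred: "\<forall>x\<in>elts R - S. \<forall>k. k = \<kappa> x \<longrightarrow>
           c k + 1 \<le> comp_length R k x \<and>
           rank_function (kindred R S \<kappa> x) (kindred_order R S \<kappa> x)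
             (comp_rank R k) (comp_length R k x - (c k + 1)) \<and>
           (\<exists>\<C>. symmetric_chain_decomposition (kindred R S \<kappa> x) (kindred_order R S \<kappa> x)
             (comp_rank R k) (comp_length R k x - (c k + 1)) \<C>)"
    for S \<kappa>
  proof -
    have dom: "\<nu> + weight s \<in> dominant_weights \<alpha> J" if s: "s \<in> S" for s
    proof -
      have "0 \<le> (\<nu> + weight s) \<bullet> coroot (\<alpha> j)" if j: "j \<in> J" for j
      proof -
        \<comment> \<open>\<open>comp_mult\<close> is a nonnegative rank minus a depth that is at
          most \<open>c j\<close> on S.\<close>
        have "0 \<le> int (c j) + comp_mult R j s"
          using S s j by (force simp: comp_mult_def)
        then have "0 \<le> real (c j) + of_int (comp_mult R j s)" by linarith
        then show ?thesis by (simp add: inner_add_left \<nu> wt_coroot j)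
      qed
      moreover have "\<nu> + weight s \<in> weight_lattice \<alpha> J"
        using assms(4) by (intro weight_lattice_add wt_weight) (simp add: dominant_weights_iff)
      ultimately show ?thesis by (simp add: dominant_weights_iff)
    qed
    \<comment> \<open>Taken with v = \<nu> + \<rho>; the Weyl vector adds 1 to each
      \<open>c j\<close>.\<close>
    have "(\<Sum>x\<in>elts R - S. alternant ?\<Phi>J (\<nu> + ?\<rho> + weight x)) = 0"
      by (rule sum_alternant_kindred[OF \<kappa>, of _ c])
         (use kindred in \<open>auto simp: inner_add_left \<nu> weyl_vector_coroot\<close>)
    then have "(\<Sum>x\<in>elts R - S. alternant ?\<Phi>J (\<nu> + weight x + ?\<rho>)) = 0"
      by (simp add: ac_simps)
    then have "bialternant ?\<Phi>J \<alpha> J \<nu> * restrict_ring \<alpha> J (WGF \<alpha> I R) =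
        (\<Sum>s\<in>S. bialternant ?\<Phi>J \<alpha> J (\<nu> + weight s))"
      unfolding WGF using S inv
      by (intro bialternant_mult_invariant finite_elts assms(4) dom) (auto simp: WGF)
    then show ?thesis using dom S assms(6) by (auto simp: splitting_poset_def)
  qed
  show ?thesis
    using weyl_invariant_rank_symmetric splitting unfolding WGF by blast
qed

end
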